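(* Let $T$ be a reduced alternating rational tangle diagram in twist form. Let $C(T)$ be any coloring of $T$ over the integers. Then all the colors appearing on the arcs of $T$ are mutually distinct. Furthermore, let $K=N(T)$ be the numerator closure of $T$ and suppose that the determinant of the link $K$ is a prime number $p$. Then for any coloring of $K$ in $\mathbb{Z}/p\mathbb{Z}$, all the colors on the arcs of $K$ are distinct in $\mathbb{Z}/p\mathbb{Z}$. In other words, if $v(K)$ denotes the number of crossings in the diagram $K$, then there will be $v(K)$ distinct colors in any coloring of the diagram $K$ in $\mathbb{Z}/p\mathbb{Z}$.
   Context: Tangle diagrams are drawn in a disc with four endpoints at NW, NE, SW, SE. $[0]$ consists of two uncrossed arcs joining NW–NE and SW–SE; $[\infty]$ of two uncrossed arcs joining NW–SW and NE–SE; $[+1]$ is the single-crossing tangle whose overcrossing strand joins NW to SE, and $[-1]$ is the opposite crossing. $T+S$: place $S$ to the right of $T$ and join NE, SE of $T$ to NW, SW of $S$. $T*S$: place $S$ below $T$ and join SW, SE of $T$ to NW, NE of $S$. A rational tangle diagram in twist form is one obtained from $[0]$ or $[\infty]$ by finitely many operations $T\mapsto T+[\pm1],\ [\pm1]+T,\ T*[\pm1],\ [\pm1]*T$. A diagram is alternating if crossings alternate between under and over along every strand. $N(T)$ is the link diagram obtained by joining NW to NE and SW to SE of $T$ by simple arcs outside the disc. A crossing of a connected link diagram is nugatory if replacing it by one of its two smoothings ($[0]$ or $[\infty]$ in place of the crossing) yields a disconnected diagram with two non-empty components. A diagram is reduced if it is connected and has no nugatory crossings. For a rational tangle diagram, reduced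 is understood as having no nugatory crossing inside the disc; any rational tangle diagram with no simplifying Reidemeister I moves is reduced. A coloring of a (tangle or link) diagram over $\mathbb{Z}$ or $\mathbb{Z}/n\mathbb{Z}$ assigns an element to each arc of the diagram (arcs running from undercrossing to undercrossing or to an endpoint) so that at each crossing the colors $\alpha,\gamma$ of the two undercrossing arcs and the color $\beta$ of the overcrossing arc satisfy $\alpha+\gamma=2\beta$. The determinant of $K$ is $|\langle K\rangle(\sqrt{i})|$, where $\langle K\rangle$ is the Kauffman bracket polynomial of $K$, evaluated at $A=\sqrt i$.
   Formalization: Colorings are taken to be non-constant (constant ones always exist and violate the claim), and in the second part the diagram K=N(T) is itself assumed reduced: for T=([1]+[1]+[1])*[1], K is a trefoil with a kink, determinant 3 but four arcs. *)

theory Defs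
  imports Complex_Main "HOL-Algebra.IntRing" "HOL-Number_Theory.Residues"
begin

(* A crossing carries four marked points, one at each corner.  The flag tells whether the
   overcrossing strand is the one from NW to SE, as in the tangle [+1]. *)
datatype crossing =
  Crossing (over_NW_SE: bool) (nw: nat) (ne: nat) (sw: nat) (se: nat)

(* The marked points of a diagram are 0, ..., npoints - 1.  A pair in joins is a crossingless
   curve between two marked points.  Edges, arcs, connected components and state circles of a
   diagram are classes of marked points, obtained by passing along the joins and along
   prescribed strands at the crossings; in particular a closed curve without crossings is a
   class of its own. *)
record diagram =
  npoints :: nat
  crossings :: "crossing list"
  joins :: "(nat \<times> nat) set"

(* The additional four points are the endpoints on the boundary of the disc. *)
record tangle = diagram +
  NW :: nat
  NE :: nat
  SW :: nat
  SE :: nat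

definition points :: "('a diagram_scheme) \<Rightarrow> nat set" where
  "points D = {..<npoints D}"

definition glue :: "('a diagram_scheme) \<Rightarrow> (nat \<times> nat) set \<Rightarrow> (nat \<times> nat) set" where
  "glue D R = ((joins D \<union> R) \<union> (joins D \<union> R)\<inverse>)\<^sup>*"


subsection \<open>Rational tangle diagrams in twist form\<close>

definition tangle_zero :: tangle where
  "tangle_zero = \<lparr>npoints = 4, crossings = [], joins = {(0, 1), (2, 3)},
     NW = 0, NE = 1, SW = 2, SE = 3\<rparr>"

definition tangle_infinity :: tangle where
  "tangle_infinity = \<lparr>npoints = 4, crossings = [], joins = {(0, 2), (1, 3)},
     NW = 0, NE = 1, SW = 2, SE = 3\<rparr>"

definition tangle_crossing :: "bool \<Rightarrow> tangle" where
  "tangle_crossing b = \<lparr>npoints = 4, crossings = [Crossing b 0 1 2 3], joins = {},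
     NW = 0, NE = 1, SW = 2, SE = 3\<rparr>"

abbreviation tangle_plus_one :: tangle where
  "tangle_plus_one \<equiv> tangle_crossing True"

abbreviation tangle_minus_one :: tangle where
  "tangle_minus_one \<equiv> tangle_crossing False"

fun shift_crossing :: "nat \<Rightarrow> crossing \<Rightarrow> crossing" where
  "shift_crossing k (Crossing b p q r s) = Crossing b (k + p) (k + q) (k + r) (k + s)"

(* Renaming of the marked points, used to make two tangles disjoint. *)
definition shift_tangle :: "nat \<Rightarrow> tangle \<Rightarrow> tangle" where
  "shift_tangle k S = \<lparr>npoints = npoints S, crossings = map (shift_crossing k) (crossings S),
     joins = map_prod ((+) k) ((+) k) ` joins S,
     NW = k + NW S, NE = k + NE S, SW = k + SW S, SE = k + SE S\<rparr>"

definition tangle_sum :: "tangle \<Rightarrow> tangle \<Rightarrow> tangle" where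
  "tangle_sum T S = (let S' = shift_tangle (npoints T) S in
     \<lparr>npoints = npoints T + npoints S, crossings = crossings T @ crossings S',
      joins = joins T \<union> joins S' \<union> {(NE T, NW S'), (SE T, SW S')},
      NW = NW T, NE = NE S', SW = SW T, SE = SE S'\<rparr>)"

definition tangle_star :: "tangle \<Rightarrow> tangle \<Rightarrow> tangle" where
  "tangle_star T S = (let S' = shift_tangle (npoints T) S in
     \<lparr>npoints = npoints T + npoints S, crossings = crossings T @ crossings S',
      joins = joins T \<union> joins S' \<union> {(SW T, NW S'), (SE T, NE S')},
      NW = NW T, NE = NE T, SW = SW S', SE = SE S'\<rparr>)"

inductive rational_twist_form :: "tangle \<Rightarrow> bool" where
  zero: "rational_twist_form tangle_zero"
| infinity: "rational_twist_form tangle_infinity"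
| sum_right: "rational_twist_form T \<Longrightarrow> E \<in> {tangle_plus_one, tangle_minus_one}
    \<Longrightarrow> rational_twist_form (tangle_sum T E)"
| sum_left: "rational_twist_form T \<Longrightarrow> E \<in> {tangle_plus_one, tangle_minus_one}
    \<Longrightarrow> rational_twist_form (tangle_sum E T)"
| star_below: "rational_twist_form T \<Longrightarrow> E \<in> {tangle_plus_one, tangle_minus_one}
    \<Longrightarrow> rational_twist_form (tangle_star T E)"
| star_above: "rational_twist_form T \<Longrightarrow> E \<in> {tangle_plus_one, tangle_minus_one}
    \<Longrightarrow> rational_twist_form (tangle_star E T)"

definition numerator :: "tangle \<Rightarrow> diagram" where
  "numerator T = \<lparr>npoints = npoints T, crossings = crossings T,
     joins = joins T \<union> {(NW T, NE T), (SW T, SE T)}\<rparr>"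


subsection \<open>Alternating diagrams\<close>

definition over_ends :: "crossing \<Rightarrow> nat \<times> nat" where
  "over_ends c = (if over_NW_SE c then (nw c, se c) else (ne c, sw c))"

definition under_ends :: "crossing \<Rightarrow> nat \<times> nat" where
  "under_ends c = (if over_NW_SE c then (ne c, sw c) else (nw c, se c))"

definition over_points :: "('a diagram_scheme) \<Rightarrow> nat set" where
  "over_points D = (\<Union>c\<in>set (crossings D). {fst (over_ends c), snd (over_ends c)})"

definition under_points :: "('a diagram_scheme) \<Rightarrow> nat set" where
  "under_points D = (\<Union>c\<in>set (crossings D). {fst (under_ends c), snd (under_ends c)})"

(* Two different crossing corners are equivalent under glue D {} iff they are the two ends of one
   edge, that is, iff a strand leaving its crossing at one of them next enters a crossing at the
   other; then one of the two passages is over and the other is under. *)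
definition alternating :: "('a diagram_scheme) \<Rightarrow> bool" where
  "alternating D \<longleftrightarrow>
     (\<forall>x\<in>over_points D. \<forall>y\<in>over_points D. x \<noteq> y \<longrightarrow> (x, y) \<notin> glue D {}) \<and>
     (\<forall>x\<in>under_points D. \<forall>y\<in>under_points D. x \<noteq> y \<longrightarrow> (x, y) \<notin> glue D {})"


subsection \<open>Smoothings and reduced diagrams\<close>

(* True stands for the smoothing [0], False for the smoothing [infinity]. *)
definition smoothing :: "bool \<Rightarrow> crossing \<Rightarrow> (nat \<times> nat) set" where
  "smoothing z c = (if z then {(nw c, ne c), (sw c, se c)} else {(nw c, sw c), (ne c, se c)})"

definition smooth_at :: "('a diagram_scheme) \<Rightarrow> nat \<Rightarrow> bool \<Rightarrow> 'a diagram_scheme" where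
  "smooth_at D i z = D\<lparr>crossings := take i (crossings D) @ drop (Suc i) (crossings D),
     joins := joins D \<union> smoothing z (crossings D ! i)\<rparr>"

(* Connected components of the diagram as a subset of the plane: all four corners of a crossing
   lie in the same component. *)
definition components :: "('a diagram_scheme) \<Rightarrow> nat set set" where
  "components D = points D //
     glue D (\<Union>c\<in>set (crossings D). {(nw c, ne c), (nw c, sw c), (nw c, se c)})"

definition connected_diagram :: "('a diagram_scheme) \<Rightarrow> bool" where
  "connected_diagram D \<longleftrightarrow> card (components D) = 1"

definition nugatory :: "diagram \<Rightarrow> nat \<Rightarrow> bool" where
  "nugatory D i \<longleftrightarrow> (\<exists>z. \<not> connected_diagram (smooth_at D i z))"

definition reduced_link :: "diagram \<Rightarrow> bool" where
  "reduced_link D \<longleftrightarrow> connected_diagram D \<and> (\<forall>i < length (crossings D). \<not> nugatory D i)"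

(* Nugatory inside the disc: a smoothing splits off a component that stays in the interior of
   the disc.  Without this restriction the single crossing of [+1] would be nugatory. *)
definition nugatory_in_disc :: "tangle \<Rightarrow> nat \<Rightarrow> bool" where
  "nugatory_in_disc T i \<longleftrightarrow>
     (\<exists>z. \<exists>X\<in>components (smooth_at T i z). X \<inter> {NW T, NE T, SW T, SE T} = {})"

definition reduced_tangle :: "tangle \<Rightarrow> bool" where
  "reduced_tangle T \<longleftrightarrow> (\<forall>i < length (crossings T). \<not> nugatory_in_disc T i)"


subsection \<open>Colorings\<close>

definition arc_rel :: "('a diagram_scheme) \<Rightarrow> (nat \<times> nat) set" where
  "arc_rel D = glue D (over_ends ` set (crossings D))"

definition arcs :: "('a diagram_scheme) \<Rightarrow> nat set set" where
  "arcs D = points D // arc_rel D"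

definition arc_of :: "('a diagram_scheme) \<Rightarrow> nat \<Rightarrow> nat set" where
  "arc_of D x = arc_rel D `` {x}"

definition coloring ::
  "('c, 'r) ring_scheme \<Rightarrow> ('a diagram_scheme) \<Rightarrow> (nat set \<Rightarrow> 'c) \<Rightarrow> bool" where
  "coloring R D C \<longleftrightarrow> C \<in> arcs D \<rightarrow> carrier R \<and>
     (\<forall>c\<in>set (crossings D).
        C (arc_of D (fst (under_ends c))) \<oplus>\<^bsub>R\<^esub> C (arc_of D (snd (under_ends c))) =
        C (arc_of D (fst (over_ends c))) \<oplus>\<^bsub>R\<^esub> C (arc_of D (fst (over_ends c))))"

(* Constant assignments always satisfy the crossing relations. *)
definition nontrivial_coloring ::
  "('c, 'r) ring_scheme \<Rightarrow> ('a diagram_scheme) \<Rightarrow> (nat set \<Rightarrow> 'c) \<Rightarrow> bool" where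
  "nontrivial_coloring R D C \<longleftrightarrow>
     coloring R D C \<and> (\<exists>a\<in>arcs D. \<exists>b\<in>arcs D. C a \<noteq> C b)"


subsection \<open>Kauffman bracket and determinant\<close>

(* The state given by S smooths the crossings with index in S in the A-way and the others in the
   B-way.  The A-smoothing joins the two regions swept out by the overcrossing strand when it is
   rotated counterclockwise; it is [0] for a crossing of type [+1] and [infinity] for a crossing
   of type [-1]. *)
definition state_circles :: "diagram \<Rightarrow> nat set \<Rightarrow> nat set set" where
  "state_circles D S = points D //
     glue D (\<Union>i<length (crossings D).
       smoothing (over_NW_SE (crossings D ! i) \<longleftrightarrow> i \<in> S) (crossings D ! i))"

(* The value at A of the Laurent polynomial, normalized to 1 on the crossingless circle. *)
definition kauffman_bracket :: "diagram \<Rightarrow> 'a::field \<Rightarrow> 'a" where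
  "kauffman_bracket D A = (\<Sum>S\<in>Pow {..<length (crossings D)}.
     A powi (int (card S) - int (card ({..<length (crossings D)} - S))) *
     (- (A powi 2) - A powi (- 2)) ^ (card (state_circles D S) - 1))"

definition determinant :: "diagram \<Rightarrow> real" where
  "determinant D = cmod (kauffman_bracket D (csqrt \<i>))"

end

theory Submission
  imports Defs
begin

text \<open>Each twist of a reduced alternating rational tangle prolongs the coloring by one new color, which
  reflects the color of a corner in an extreme color and so lies beyond all the earlier ones.  Hence
  every integer coloring is an affine image of a universal one, whose colors are distinct and fill
  the range from one corner to the opposite one.  The differences \<open>a\<close> and \<open>b\<close> between the
  corner colors obey the same recursion as the state sums of the two planar ways to connect the
  four ends: at \<open>A = \<surd>\<i>\<close> every free circle contributes \<open>0\<close>, and the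
  remaining states have phases depending only on the way they connect the ends.  So the determinant
  of the numerator closure is one of these differences.  In a reduced closure the last twist is a
  horizontal one, and the determinant \<open>p\<close> is the full range of colors of the tangle before this
  twist.  Its colors are thus distinct modulo \<open>p\<close> except for the two extreme ones, which the
  closure places on the same arc.\<close>

text \<open>Four operations with two types of crossing would give eight parallel inductions. They
  become one because \<open>alternating_twist\<close> forgets the compass names of the corners: only
  the quadrilateral with the cyclic order \<open>p r q t\<close> is kept, and \<open>flip\<close>
  and \<open>switch\<close> bring any of its sides to the side \<open>p t\<close>, the only place
  where the inductive step attaches a crossing. Alternation serves to force the type of the next
  crossing: \<open>p\<close> and \<open>q\<close> lead to under passages, \<open>r\<close> and
  \<open>t\<close> to over passages. Reducedness of the tangle excludes a twist with weight 0, which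
  is possible only on a tangle without crossings. The weights come from Conway's fraction:
  \<open>b / a\<close> is its absolute value, with 0/1 for [0] and 1/0 for [\<infinity>]; a
  horizontal twist leads to \<open>(a + b) / a\<close>, a vertical one to
  \<open>b / (a + b)\<close>. The obstacle in the second part is that the colors of the whole tangle
  range up to \<open>2 * a + b\<close>, beyond the determinant \<open>a + b\<close>, so that
  distinct integers do not directly give distinct residues. This forces the step back to the tangle
  before its last twist.\<close>

definition sym_closure :: "('a \<times> 'a) set \<Rightarrow> ('a \<times> 'a) set" where
  "sym_closure R = R \<union> R\<inverse>"

lemma sym_closure_Un: "sym_closure (R \<union> S) = sym_closure R \<union> sym_closure S"
  by (auto simp: sym_closure_def)

lemma sym_closure_empty [simp]: "sym_closure {} = {}"
  by (simp add: sym_closure_def)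

lemma sym_closure_insert: "sym_closure (insert (x, y) R) = {(x, y), (y, x)} \<union> sym_closure R"
  by (auto simp: sym_closure_def)

lemma sym_closure_mono: "R \<subseteq> S \<Longrightarrow> sym_closure R \<subseteq> sym_closure S"
  by (auto simp: sym_closure_def)

lemma sym_sym_closure: "sym (sym_closure R)"
  by (auto simp: sym_closure_def sym_def)

lemma sym_closure_subset: "R \<subseteq> P \<times> P \<Longrightarrow> sym_closure R \<subseteq> P \<times> P"
  by (auto simp: sym_closure_def)

lemma sym_closure_map_prod: "sym_closure (map_prod h h ` R) = map_prod h h ` sym_closure R"
proof -
  have "(map_prod h h ` R)\<inverse> = map_prod h h ` R\<inverse>"
    by (auto simp: image_iff)
  then show ?thesis by (simp only: sym_closure_def image_Un)
qed

lemma glue_eq: "glue D R = (sym_closure (joins D) \<union> sym_closure R)\<^sup>*"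
  by (simp add: glue_def sym_closure_def Un_ac converse_Un)

lemma equiv_rtrancl: "sym G \<Longrightarrow> equiv UNIV (G\<^sup>*)"
  by (simp add: equiv_def refl_rtrancl sym_rtrancl trans_rtrancl)

lemma rtrancl_closed: "(x, y) \<in> G\<^sup>* \<Longrightarrow> x \<in> X \<Longrightarrow> G `` X \<subseteq> X \<Longrightarrow> y \<in> X"
  by (induction rule: rtrancl_induct) auto

lemma rtrancl_map_prod:
  "(x, y) \<in> G\<^sup>* \<Longrightarrow> (h x, h y) \<in> (map_prod h h ` G)\<^sup>*"
  by (induction rule: rtrancl_induct) (auto intro: rtrancl_into_rtrancl)

section \<open>Components of a graph\<close>

text \<open>This is the class of any point of \<open>X\<close>, stated so that the effect of one
  more edge is easily read off: the edge merges two components, lies inside one, or misses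
  it.\<close>

definition component :: "('a \<times> 'a) set \<Rightarrow> 'a set \<Rightarrow> bool" where
  "component G X \<longleftrightarrow> X \<noteq> {} \<and> X \<times> X \<subseteq> G\<^sup>* \<and> G `` X \<subseteq> X"

lemma component_class:
  assumes "component G X" "x \<in> X"
  shows "G\<^sup>* `` {x} = X"
  using assms rtrancl_closed[of x _ G X] unfolding component_def by blast

lemma component_unique:
  "component G X \<Longrightarrow> component G Y \<Longrightarrow> x \<in> X \<Longrightarrow> x \<in> Y \<Longrightarrow> X = Y"
  by (metis component_class)

lemma component_singleton: "y \<notin> Domain G \<Longrightarrow> component G {y}"
  by (auto simp: component_def)

lemma component_mono:
  "component G X \<Longrightarrow> G \<subseteq> H \<Longrightarrow> H `` X \<subseteq> X \<Longrightarrow> component H X"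
  using rtrancl_mono[of G H] unfolding component_def by blast

definition add_edge :: "'a \<Rightarrow> 'a \<Rightarrow> ('a \<times> 'a) set \<Rightarrow> ('a \<times> 'a) set" where
  "add_edge x y G = G \<union> {(x, y), (y, x)}"

lemma component_merge:
  assumes "component G X" "component G Y" "x \<in> X" "y \<in> Y"
  shows "component (add_edge x y G) (X \<union> Y)"
proof -
  let ?H = "G \<union> {(x, y), (y, x)}"
  have GH: "G\<^sup>* \<subseteq> ?H\<^sup>*" by (rule rtrancl_mono) auto
  have X: "X \<times> X \<subseteq> ?H\<^sup>*" and Y: "Y \<times> Y \<subseteq> ?H\<^sup>*"
    using assms GH unfolding component_def by blast+
  have xy: "(x, y) \<in> ?H\<^sup>*" "(y, x) \<in> ?H\<^sup>*" by auto
  have "(u, v) \<in> ?H\<^sup>*" if "u \<in> X" "v \<in> Y" for u v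
  proof -
    have "(u, x) \<in> ?H\<^sup>*" "(y, v) \<in> ?H\<^sup>*" using X Y that assms by auto
    then show ?thesis using xy(1) by (meson rtrancl_trans)
  qed
  moreover have "(v, u) \<in> ?H\<^sup>*" if "u \<in> X" "v \<in> Y" for u v
  proof -
    have "(x, u) \<in> ?H\<^sup>*" "(v, y) \<in> ?H\<^sup>*" using X Y that assms by auto
    then show ?thesis using xy(2) by (meson rtrancl_trans)
  qed
  ultimately have "(X \<union> Y) \<times> (X \<union> Y) \<subseteq> ?H\<^sup>*" using X Y by auto
  moreover have "?H `` (X \<union> Y) \<subseteq> X \<union> Y" using assms unfolding component_def by auto
  ultimately show ?thesis using assms(3) by (auto simp: component_def add_edge_def)
qed

lemma component_insert:
  "component G X \<Longrightarrow> component G {y} \<Longrightarrow> x \<in> X \<Longrightarrow> component (add_edge x y G) (insert y X)"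
  using component_merge[of G X "{y}" x y] by simp

lemma component_inside:
  "component G X \<Longrightarrow> x \<in> X \<Longrightarrow> y \<in> X \<Longrightarrow> component (add_edge x y G) X"
  using component_merge[of G X X x y] by simp

lemma component_keep:
  "component G Z \<Longrightarrow> x \<notin> Z \<Longrightarrow> y \<notin> Z \<Longrightarrow> component (add_edge x y G) Z"
  unfolding add_edge_def by (rule component_mono[of G]) (unfold component_def, blast+)

lemma component_map_prod:
  assumes "component G X" "inj h"
  shows "component (map_prod h h ` G) (h ` X)"
proof -
  have "h ` X \<times> h ` X \<subseteq> (map_prod h h ` G)\<^sup>*"
    using assms(1) by (auto simp: component_def intro: rtrancl_map_prod)
  moreover have "(map_prod h h ` G) `` (h ` X) \<subseteq> h ` X"
    using assms by (auto simp: component_def dest: injD)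
  ultimately show ?thesis using assms(1) by (auto simp: component_def)
qed

lemma quotient_component:
  assumes "sym G" "X \<in> P // G\<^sup>*"
  shows "component G X"
proof -
  obtain x where "x \<in> P" and X: "X = G\<^sup>* `` {x}" using assms(2) by (auto elim: quotientE)
  have "(u, v) \<in> G\<^sup>*" if "(x, u) \<in> G\<^sup>*" "(x, v) \<in> G\<^sup>*" for u v
    using that sym_rtrancl[OF assms(1)] by (meson rtrancl_trans symD)
  then show ?thesis unfolding component_def X by (auto intro: rtrancl_into_rtrancl)
qed

lemma component_quotient:
  "component G X \<Longrightarrow> x \<in> X \<Longrightarrow> x \<in> P \<Longrightarrow> X \<in> P // G\<^sup>*"
  by (metis component_class quotientI)

section \<open>Alternating twists\<close>

text \<open>The corners are taken in the cyclic order \<open>o1 u1 o2 u2\<close>, whatever their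
  compass names; \<open>o1\<close> and \<open>u1\<close> are to face the tangle. One smoothing leads
  both strands across the crossing, the other turns both back, and \<open>w\<close> says that the
  A-smoothing is the one leading across.\<close>

definition twist_crossing :: "crossing \<Rightarrow> bool \<Rightarrow> nat \<Rightarrow> nat \<Rightarrow> nat \<Rightarrow> nat \<Rightarrow> bool" where
  "twist_crossing c w o1 o2 u1 u2 \<longleftrightarrow>
     over_ends c \<in> {(o1, o2), (o2, o1)} \<and> under_ends c \<in> {(u1, u2), (u2, u1)} \<and>
     sym_closure (smoothing (over_NW_SE c = w) c) = sym_closure {(o1, u2), (u1, o2)} \<and>
     sym_closure (smoothing (over_NW_SE c \<noteq> w) c) = sym_closure {(o1, u1), (o2, u2)}"

text \<open>A tangle with points \<open>P\<close>, crossings \<open>cs\<close>, symmetrized joins \<open>E\<close> and corners \<open>p\<close>, \<open>q\<close>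
  (opposite, with the extreme colors) and \<open>r\<close>, \<open>t\<close>.  A-smoothings connect the corners of a
  crossing in the pairing \<open>p-r, q-t\<close> if \<open>w\<close> holds and in \<open>p-t, q-r\<close> otherwise.  The weight
  \<open>a\<close> is the color difference of \<open>p\<close> and \<open>t\<close> and counts the states pairing \<open>p\<close> with \<open>r\<close>;
  \<open>b\<close> has the same roles with \<open>r\<close> and \<open>t\<close> exchanged.  A twist at \<open>p\<close> and \<open>t\<close> with
  \<open>a = 0\<close> would be a kink.\<close>

inductive alternating_twist :: "bool \<Rightarrow> nat set \<Rightarrow> crossing list \<Rightarrow> (nat \<times> nat) set \<Rightarrow>
    nat \<Rightarrow> nat \<Rightarrow> nat \<Rightarrow> nat \<Rightarrow> int \<Rightarrow> int \<Rightarrow> bool" where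
  base: "distinct [p, q, r, t] \<Longrightarrow> P = {p, q, r, t} \<Longrightarrow> E = sym_closure {(p, r), (q, t)} \<Longrightarrow>
    alternating_twist w P [] E p q r t 1 0"
| flip: "alternating_twist w P cs E p q r t a b \<Longrightarrow> alternating_twist w P cs E q p t r a b"
| switch: "alternating_twist w P cs E p q r t a b \<Longrightarrow>
    alternating_twist (\<not> w) P cs E p q t r b a"
| attach: "alternating_twist w P cs E p q r t a b \<Longrightarrow> 0 < a \<Longrightarrow>
    twist_crossing c w o1 o2 u1 u2 \<Longrightarrow> distinct [o1, o2, u1, u2] \<Longrightarrow>
    {o1, o2, u1, u2} \<inter> P = {} \<Longrightarrow> cs' \<in> {c # cs, cs @ [c]} \<Longrightarrow>
    P' = P \<union> {o1, o2, u1, u2} \<Longrightarrow> E' = E \<union> sym_closure {(p, o1), (t, u1)} \<Longrightarrow>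
    alternating_twist w P' cs' E' u2 q r o2 a (a + b)"

text \<open>The last conjunct shows that after the first crossing a kink can no longer arise: both
  weights stay positive.\<close>

lemma alternating_twist_wf:
  "alternating_twist w P cs E p q r t a b \<Longrightarrow>
    finite P \<and> distinct [p, q, r, t] \<and> {p, q, r, t} \<subseteq> P \<and> E \<subseteq> P \<times> P \<and> sym E \<and> 0 \<le> a \<and> 0 \<le> b \<and>
    0 < a + b \<and> (cs \<noteq> [] \<longrightarrow> 0 < a \<and> 0 < b)"
proof (induction rule: alternating_twist.induct)
  case (base p q r t P E w)
  have "sym E" unfolding base by (rule sym_sym_closure)
  then show ?case using base by (simp add: sym_closure_insert)
next
  case (attach w P cs E p q r t a b c o1 o2 u1 u2 cs' P' E')
  from attach.IH have IH: "finite P" "distinct [p, q, r, t]" "p \<in> P" "q \<in> P" "r \<in> P" "t \<in> P"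
    "E \<subseteq> P \<times> P" "sym E" "0 \<le> a" "0 \<le> b" by auto
  have "sym E'"
    unfolding attach.hyps(8) using IH(8) by (intro sym_Un sym_sym_closure)
  moreover have "E' \<subseteq> P' \<times> P'"
    unfolding attach.hyps(7,8)
  proof (rule Un_least)
    show "E \<subseteq> (P \<union> {o1, o2, u1, u2}) \<times> (P \<union> {o1, o2, u1, u2})" using IH(7) by blast
    show "sym_closure {(p, o1), (t, u1)} \<subseteq> (P \<union> {o1, o2, u1, u2}) \<times> (P \<union> {o1, o2, u1, u2})"
      by (rule sym_closure_subset) (use IH(3,6) in simp)
  qed
  moreover have "finite P'" "{u2, q, r, o2} \<subseteq> P'"
    unfolding attach.hyps(7) using IH(1,4,5) by auto
  moreover have "distinct [u2, q, r, o2]"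
    using IH(2,4,5) attach.hyps(4,5) by auto
  ultimately show ?case using IH(9,10) attach.hyps(2) by simp
qed auto

lemma twist_crossing_shift:
  "twist_crossing c w o1 o2 u1 u2 \<Longrightarrow>
    twist_crossing (shift_crossing k c) w (k + o1) (k + o2) (k + u1) (k + u2)"
proof -
  assume c: "twist_crossing c w o1 o2 u1 u2"
  have s: "smoothing z (shift_crossing k c) = map_prod ((+) k) ((+) k) ` smoothing z c" for z
    by (cases c) (simp add: smoothing_def)
  have *: "over_ends (shift_crossing k c) = map_prod ((+) k) ((+) k) (over_ends c)"
    "under_ends (shift_crossing k c) = map_prod ((+) k) ((+) k) (under_ends c)"
    "over_NW_SE (shift_crossing k c) = over_NW_SE c"
    by (cases c, simp add: over_ends_def under_ends_def)+
  have **: "sym_closure {(k + x, k + y), (k + x', k + y')} =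
      map_prod ((+) k) ((+) k) ` sym_closure {(x, y), (x', y')}" for x y x' y'
    by (simp add: sym_closure_insert insert_commute)
  show ?thesis
    using c unfolding twist_crossing_def s * sym_closure_map_prod ** by auto
qed

lemma alternating_twist_shift:
  "alternating_twist w P cs E p q r t a b \<Longrightarrow>
    alternating_twist w ((+) k ` P) (map (shift_crossing k) cs) (map_prod ((+) k) ((+) k) ` E)
      (k + p) (k + q) (k + r) (k + t) a b"
proof (induction rule: alternating_twist.induct)
  case (base p q r t P E w)
  then show ?case
    unfolding list.map
    by (intro alternating_twist.base) (simp_all add: sym_closure_insert insert_commute)
next
  case (flip w P cs E p q r t a b)
  show ?case by (rule alternating_twist.flip[OF flip.IH])
next
  case (switch w P cs E p q r t a b)
  show ?case by (rule alternating_twist.switch[OF switch.IH])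
next
  case (attach w P cs E p q r t a b c o1 o2 u1 u2 cs' P' E')
  show ?case
  proof (rule alternating_twist.attach[OF attach.IH \<open>0 < a\<close> twist_crossing_shift[OF attach.hyps(3)]])
    show "distinct [k + o1, k + o2, k + u1, k + u2]" using attach.hyps(4) by simp
    show "{k + o1, k + o2, k + u1, k + u2} \<inter> (+) k ` P = {}" using attach.hyps(5) by auto
    show "map (shift_crossing k) cs' \<in> {shift_crossing k c # map (shift_crossing k) cs,
        map (shift_crossing k) cs @ [shift_crossing k c]}"
      using attach.hyps(6) by auto
    show "(+) k ` P' = (+) k ` P \<union> {k + o1, k + o2, k + u1, k + u2}"
      by (simp only: attach.hyps(7) image_Un image_insert image_empty)
    show "map_prod ((+) k) ((+) k) ` E' =
        map_prod ((+) k) ((+) k) ` E \<union> sym_closure {(k + p, k + o1), (k + t, k + u1)}"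
      by (simp only: attach.hyps(8) image_Un sym_closure_map_prod[symmetric]
          image_insert image_empty map_prod_simp)
  qed
qed

section \<open>Colorings\<close>

definition mod_coloring :: "int \<Rightarrow> crossing list \<Rightarrow> (nat \<times> nat) set \<Rightarrow> (nat \<Rightarrow> int) \<Rightarrow> bool" where
  "mod_coloring n cs E f \<longleftrightarrow>
     (\<forall>(x, y)\<in>E. [f x = f y] (mod n)) \<and>
     (\<forall>c\<in>set cs. [f (fst (over_ends c)) = f (snd (over_ends c))] (mod n) \<and>
       [f (fst (under_ends c)) + f (snd (under_ends c)) = 2 * f (fst (over_ends c))] (mod n))"

abbreviation arc_graph :: "crossing list \<Rightarrow> (nat \<times> nat) set \<Rightarrow> (nat \<times> nat) set" where
  "arc_graph cs E \<equiv> E \<union> sym_closure (over_ends ` set cs)"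

text \<open>\<open>g\<close> is the universal coloring, normalized to 0 at \<open>q\<close>. The
  crossingless tangle has two arcs and each crossing adds one, hence \<open>length cs + 2\<close>
  values. The modulus is quantified after \<open>g\<close>, so the same \<open>g\<close> serves the
  integers, as modulus 0, and the residues modulo a prime.\<close>

lemma alternating_twist_coloring:
  "alternating_twist w P cs E p q r t a b \<Longrightarrow> \<exists>g :: nat \<Rightarrow> int.
    g q = 0 \<and> g r = a \<and> g t = b \<and> g p = a + b \<and> g ` P \<subseteq> {0..a + b} \<and>
    card (g ` P) = length cs + 2 \<and>
    (\<forall>x\<in>P. \<forall>y\<in>P. g x = g y \<longrightarrow> (x, y) \<in> (arc_graph cs E)\<^sup>*) \<and>
    (\<forall>n f. mod_coloring n cs E f \<longrightarrow> (\<exists>\<alpha> m. \<forall>x\<in>P. [f x = \<alpha> + m * g x] (mod n)))"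
proof (induction rule: alternating_twist.induct)
  case (base p q r t P E w)
  define g :: "nat \<Rightarrow> int" where "g x = (if x = p \<or> x = r then 1 else 0)" for x
  have "g ` P = {0, 1}" using base(1) unfolding base(2) g_def by auto
  moreover have "\<forall>x\<in>P. \<forall>y\<in>P. g x = g y \<longrightarrow> (x, y) \<in> (arc_graph [] E)\<^sup>*"
    using base(1) unfolding base(2,3) g_def by (auto simp: sym_closure_insert)
  moreover have "\<exists>\<alpha> m. \<forall>x\<in>P. [f x = \<alpha> + m * g x] (mod n)" if "mod_coloring n [] E f" for n f
  proof (intro exI ballI)
    fix x assume "x \<in> P"
    have "[f r = f p] (mod n)" "[f t = f q] (mod n)"
      using that unfolding mod_coloring_def base(3) by (simp_all add: sym_closure_insert)
    then show "[f x = f q + (f p - f q) * g x] (mod n)"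
      using \<open>x \<in> P\<close> base(1) unfolding base(2) g_def by (elim insertE) simp_all
  qed
  ultimately show ?case using base(1) by (intro exI[of _ g]) (simp add: g_def)
next
  case (flip w P cs E p q r t a b)
  then obtain g :: "nat \<Rightarrow> int" where g: "g q = 0" "g r = a" "g t = b" "g p = a + b" "g ` P \<subseteq> {0..a + b}"
    "card (g ` P) = length cs + 2" "\<forall>x\<in>P. \<forall>y\<in>P. g x = g y \<longrightarrow> (x, y) \<in> (arc_graph cs E)\<^sup>*"
    "\<forall>n f. mod_coloring n cs E f \<longrightarrow> (\<exists>\<alpha> m. \<forall>x\<in>P. [f x = \<alpha> + m * g x] (mod n))" by blast
  \<comment> \<open>Reflecting the range of colors exchanges the extreme corners \<open>p\<close>
    and \<open>q\<close>, and with them \<open>r\<close> and \<open>t\<close>.\<close>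
  let ?h = "\<lambda>x. a + b - g x"
  have "?h ` P = (\<lambda>x. a + b - x) ` g ` P" by (simp add: image_image)
  then have "card (?h ` P) = length cs + 2"
    using g(6) by (simp add: card_image inj_on_def)
  moreover have "\<exists>\<alpha> m. \<forall>x\<in>P. [f x = \<alpha> + m * ?h x] (mod n)" if f: "mod_coloring n cs E f" for n f
  proof -
    obtain \<alpha> m where *: "\<forall>x\<in>P. [f x = \<alpha> + m * g x] (mod n)" using g(8) f by blast
    have "\<alpha> + m * g x = (\<alpha> + m * (a + b)) + (- m) * ?h x" for x by (simp add: algebra_simps)
    then show ?thesis using * by metis
  qed
  ultimately show ?case using g(1-5,7) by (intro exI[of _ ?h]) auto
next
  case (switch w P cs E p q r t a b)
  then show ?case by (metis add.commute)
next
  case (attach w P cs E p q r t a b c o1 o2 u1 u2 cs' P' E')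
  from attach.IH obtain g :: "nat \<Rightarrow> int" where g: "g q = 0" "g r = a" "g t = b" "g p = a + b"
    "g ` P \<subseteq> {0..a + b}"
    "card (g ` P) = length cs + 2" "\<And>x y. x \<in> P \<Longrightarrow> y \<in> P \<Longrightarrow> g x = g y \<Longrightarrow> (x, y) \<in> (arc_graph cs E)\<^sup>*"
    "\<And>n f. mod_coloring n cs E f \<Longrightarrow> (\<exists>\<alpha> m. \<forall>x\<in>P. [f x = \<alpha> + m * g x] (mod n))" by blast
  from alternating_twist_wf[OF attach.hyps(1)]
  have wf: "finite P" "p \<in> P" "q \<in> P" "r \<in> P" "t \<in> P" "sym E" "0 \<le> a" "0 \<le> b" by auto
  have set_cs': "set cs' = insert c (set cs)" and len: "length cs' = Suc (length cs)"
    using attach.hyps(6) by auto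
  have ends: "over_ends c \<in> {(o1, o2), (o2, o1)}" "under_ends c \<in> {(u1, u2), (u2, u1)}"
    using attach.hyps(3) by (simp_all add: twist_crossing_def)
  have new: "o1 \<notin> P" "o2 \<notin> P" "u1 \<notin> P" "u2 \<notin> P" "o1 \<noteq> o2" "o1 \<noteq> u1" "o1 \<noteq> u2" "o2 \<noteq> u1" "o2 \<noteq> u2" "u1 \<noteq> u2"
    using attach.hyps(4,5) by auto
  let ?A = "arc_graph cs E" and ?A' = "arc_graph cs' E'"
  \<comment> \<open>\<open>o1\<close> and \<open>o2\<close> continue the arc of \<open>p\<close>,
    and \<open>u1\<close> that of \<open>t\<close>. The color \<open>x\<close> of \<open>u2\<close>
    solves the crossing relation \<open>b + x = 2 * (a + b)\<close>; it exceeds the old maximum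
    \<open>a + b\<close> because \<open>0 < a\<close>.\<close>
  define h where "h = g(o1 := a + b, o2 := a + b, u1 := b, u2 := 2 * a + b)"
  have hP: "h x = g x" if "x \<in> P" for x using that new by (auto simp: h_def)
  have hnew: "h o1 = a + b" "h o2 = a + b" "h u1 = b" "h u2 = 2 * a + b"
    using new by (simp_all add: h_def)
  have mono: "?A\<^sup>* \<subseteq> ?A'\<^sup>*"
    unfolding attach.hyps(8) set_cs' by (rule rtrancl_mono) (auto simp: sym_closure_def)
  have "sym ?A'" unfolding attach.hyps(8) using wf(6) by (intro sym_Un sym_sym_closure)
  then have symA: "(y, x) \<in> ?A'\<^sup>*" if "(x, y) \<in> ?A'\<^sup>*" for x y
    using that by (meson sym_rtrancl symD)
  have "(o1, p) \<in> ?A'" "(u1, t) \<in> ?A'" "(o2, o1) \<in> ?A'"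
    unfolding attach.hyps(8) set_cs' using ends(1) by (auto simp: sym_closure_def)
  then have edges: "(o1, p) \<in> ?A'\<^sup>*" "(u1, t) \<in> ?A'\<^sup>*" "(o2, p) \<in> ?A'\<^sup>*"
    by (auto intro: rtrancl_into_rtrancl converse_rtrancl_into_rtrancl)
  have hP': "h ` P' = insert (2 * a + b) (g ` P)"
  proof -
    have "h ` P' = h ` P \<union> {h o1, h o2, h u1, h u2}" unfolding attach.hyps(7) by auto
    also have "h ` P = g ` P" using hP by auto
    finally have "h ` P' = g ` P \<union> {g p, g t, 2 * a + b}" using g(3,4) hnew by auto
    then show ?thesis using wf(2,5) by auto
  qed
  have notin: "2 * a + b \<notin> g ` P" using g(5) \<open>0 < a\<close> by auto
  have range: "h ` P' \<subseteq> {0..a + (a + b)}" using g(5) wf(7,8) unfolding hP' by auto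
  have card: "card (h ` P') = length cs' + 2"
    using notin wf(1) g(6) len unfolding hP' by simp
  \<comment> \<open>Every point but \<open>u2\<close> lies on an arc that already meets the old
    tangle, so injectivity on arcs is inherited.\<close>
  have repr: "\<exists>z\<in>P. (x, z) \<in> ?A'\<^sup>* \<and> h x = g z" if x: "x \<in> P'" "x \<noteq> u2" for x
  proof -
    consider "x \<in> P" | "x = o1" | "x = o2" | "x = u1" using x unfolding attach.hyps(7) by auto
    then show ?thesis
      using hP hnew edges wf(2,5) g(3,4) by cases (force intro: bexI[of _ p] bexI[of _ t])+
  qed
  have inj: "(x, y) \<in> ?A'\<^sup>*" if xy: "x \<in> P'" "y \<in> P'" "h x = h y" for x y
  proof (cases "x = u2 \<or> y = u2")
    case True
    have "z = u2" if "z \<in> P'" "h z = 2 * a + b" for z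
      using repr[of z] that notin by auto
    then have "x = y" using True xy hnew(4) by metis
    then show ?thesis by simp
  next
    case False
    then obtain x' y' where *: "x' \<in> P" "(x, x') \<in> ?A'\<^sup>*" "h x = g x'" "y' \<in> P" "(y, y') \<in> ?A'\<^sup>*" "h y = g y'"
      using repr xy by meson
    then have "(x', y') \<in> ?A'\<^sup>*" using g(7)[of x' y'] xy(3) mono by auto
    then show ?thesis using *(2) symA[OF *(5)] by (meson rtrancl_trans)
  qed
  have universal: "\<exists>\<alpha> m. \<forall>x\<in>P'. [f x = \<alpha> + m * h x] (mod n)" if f: "mod_coloring n cs' E' f" for n f
  proof -
    have "mod_coloring n cs E f" using f unfolding mod_coloring_def set_cs' attach.hyps(8) by auto
    then obtain \<alpha> m where *: "\<And>x. x \<in> P \<Longrightarrow> [f x = \<alpha> + m * g x] (mod n)" using g(8) by blast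
    have "[f o1 = f p] (mod n)" "[f u1 = f t] (mod n)"
      using f unfolding mod_coloring_def attach.hyps(8) by (auto simp: sym_closure_insert)
    then have f1: "[f o1 = \<alpha> + m * (a + b)] (mod n)" "[f u1 = \<alpha> + m * b] (mod n)"
      using *[OF wf(2)] *[OF wf(5)] g(3,4) by (metis cong_trans)+
    have c: "[f (fst (over_ends c)) = f (snd (over_ends c))] (mod n)"
      "[f (fst (under_ends c)) + f (snd (under_ends c)) = 2 * f (fst (over_ends c))] (mod n)"
      using f unfolding mod_coloring_def set_cs' by auto
    have "[f o2 = f o1] (mod n)" using c(1) ends(1) by (auto simp: cong_sym_eq)
    then have f2: "[f o2 = \<alpha> + m * (a + b)] (mod n)" using f1(1) by (rule cong_trans)
    have "[f (fst (over_ends c)) = \<alpha> + m * (a + b)] (mod n)" using f1(1) f2 ends(1) by auto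
    then have "[2 * f (fst (over_ends c)) = 2 * (\<alpha> + m * (a + b))] (mod n)" by (rule cong_scalar_left)
    with c(2) have "[f (fst (under_ends c)) + f (snd (under_ends c)) = 2 * (\<alpha> + m * (a + b))] (mod n)"
      by (rule cong_trans)
    then have "[f u1 + f u2 = 2 * (\<alpha> + m * (a + b))] (mod n)" using ends(2) by (auto simp: add.commute)
    from cong_diff[OF this f1(2)] have "[f u2 = \<alpha> + m * (2 * a + b)] (mod n)"
      by (simp add: algebra_simps)
    then have "\<forall>x\<in>P'. [f x = \<alpha> + m * h x] (mod n)"
      using * f1 f2 hP hnew unfolding attach.hyps(7) by auto
    then show ?thesis by blast
  qed
  have "h q = 0" "h r = a" "h o2 = a + b" "h u2 = a + (a + b)" using hP wf(3,4) g(1,2) hnew by auto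
  then show ?case using range card inj universal by blast
qed

section \<open>State sums\<close>

primrec states :: "crossing list \<Rightarrow> (nat \<times> nat) set set" where
  "states [] = {{}}"
| "states (c # cs) = (\<Union>R\<in>states cs. {R \<union> smoothing True c, R \<union> smoothing False c})"

lemma states_snoc: "states (cs @ [c]) = states (c # cs)"
  by (induction cs) (auto simp: Un_ac)

text \<open>The value \<open>h\<close> of a state is left arbitrary so that an induction can absorb
  a smoothing into it. The first summand takes the A-smoothing.\<close>

primrec state_sum :: "'a::field \<Rightarrow> crossing list \<Rightarrow> ((nat \<times> nat) set \<Rightarrow> 'a) \<Rightarrow> 'a" where
  "state_sum A [] h = h {}"
| "state_sum A (c # cs) h =
    A * state_sum A cs (\<lambda>R. h (R \<union> smoothing (over_NW_SE c) c)) +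
    inverse A * state_sum A cs (\<lambda>R. h (R \<union> smoothing (\<not> over_NW_SE c) c))"

text \<open>The twisting operations put the new crossing at either end of the list; the sum does not
  see the difference.\<close>

lemma state_sum_snoc: "state_sum A (cs @ [c]) h = state_sum A (c # cs) h"
  by (induction cs arbitrary: h) (simp_all add: Un_ac algebra_simps)

lemma state_sum_cong:
  "(\<And>R. R \<in> states cs \<Longrightarrow> h R = h' R) \<Longrightarrow> state_sum A cs h = state_sum A cs h'"
proof (induction cs arbitrary: h h')
  case (Cons c cs)
  have "state_sum A cs (\<lambda>R. h (R \<union> smoothing z c)) = state_sum A cs (\<lambda>R. h' (R \<union> smoothing z c))" for z
    by (rule Cons.IH) (rule Cons.prems, cases z, auto)
  then show ?case by simp
qed simp

lemma state_sum_zero: "state_sum A cs (\<lambda>R. 0) = 0"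
  by (induction cs) simp_all

text \<open>The induction removes the last crossing, since this keeps the indices of the others. The
  subsets are split by whether they contain the last index, which changes the exponent by plus or
  minus one.\<close>

lemma state_sum_Pow:
  assumes "A \<noteq> 0"
  shows "(\<Sum>S\<in>Pow {..<length cs}.
      A powi (int (card S) - int (card ({..<length cs} - S))) *
      h (\<Union>i<length cs. smoothing (over_NW_SE (cs ! i) \<longleftrightarrow> i \<in> S) (cs ! i))) = state_sum A cs h"
proof (induction cs arbitrary: h rule: rev_induct)
  case (snoc c cs)
  let ?n = "length cs"
  let ?U = "\<lambda>S. \<Union>i<?n. smoothing (over_NW_SE (cs ! i) \<longleftrightarrow> i \<in> S) (cs ! i)"
  let ?V = "\<lambda>S. \<Union>i<Suc ?n. smoothing (over_NW_SE ((cs @ [c]) ! i) \<longleftrightarrow> i \<in> S) ((cs @ [c]) ! i)"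
  let ?F = "\<lambda>S. A powi (int (card S) - int (card ({..<Suc ?n} - S))) * h (?V S)"
  have V: "?V S = ?U S \<union> smoothing (over_NW_SE c \<longleftrightarrow> ?n \<in> S) c" for S
    by (auto simp: lessThan_Suc nth_append)
  have pw: "A powi (k - 1) = inverse A * A powi k" "A powi (k + 1) = A * A powi k" for k
    using assms by (simp_all add: power_int_diff power_int_add divide_simps)
  have out: "?F S = inverse A * (A powi (int (card S) - int (card ({..<?n} - S))) *
      h (?U S \<union> smoothing (\<not> over_NW_SE c) c))" if "S \<in> Pow {..<?n}" for S
  proof -
    have nS: "?n \<notin> S" using that by auto
    then have "{..<Suc ?n} - S = insert ?n ({..<?n} - S)" by auto
    then have "card ({..<Suc ?n} - S) = Suc (card ({..<?n} - S))" by simp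
    then have *: "int (card S) - int (card ({..<Suc ?n} - S)) =
        int (card S) - int (card ({..<?n} - S)) - 1" by simp
    show ?thesis unfolding * pw V using nS by simp
  qed
  have "in": "?F (insert ?n S) = A * (A powi (int (card S) - int (card ({..<?n} - S))) *
      h (?U S \<union> smoothing (over_NW_SE c) c))" if "S \<in> Pow {..<?n}" for S
  proof -
    have nS: "?n \<notin> S" "finite S" using that by (auto intro: finite_subset)
    have "{..<Suc ?n} - insert ?n S = {..<?n} - S" by auto
    then have *: "int (card (insert ?n S)) - int (card ({..<Suc ?n} - insert ?n S)) =
        int (card S) - int (card ({..<?n} - S)) + 1" using nS by simp
    have "?U (insert ?n S) = ?U S" by auto
    then show ?thesis unfolding * pw V by simp
  qed
  have "sum ?F (Pow {..<Suc ?n}) = sum ?F (Pow {..<?n}) + sum ?F (insert ?n ` Pow {..<?n})"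
    unfolding lessThan_Suc Pow_insert by (rule sum.union_disjoint) auto
  also have "sum ?F (insert ?n ` Pow {..<?n}) = (\<Sum>S\<in>Pow {..<?n}. ?F (insert ?n S))"
  proof (rule sum.reindex[unfolded o_def])
    show "inj_on (insert ?n) (Pow {..<?n})" unfolding inj_on_def
      by (metis PowD insert_ident lessThan_iff less_irrefl subset_iff)
  qed
  also have "sum ?F (Pow {..<?n}) + \<dots> =
      inverse A * state_sum A cs (\<lambda>R. h (R \<union> smoothing (\<not> over_NW_SE c) c)) +
      A * state_sum A cs (\<lambda>R. h (R \<union> smoothing (over_NW_SE c) c))"
    unfolding snoc.IH[symmetric] sum_distrib_left using out "in" by (intro arg_cong2[where f = "(+)"] sum.cong) auto
  finally show ?case by (simp add: state_sum_snoc add.commute)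
qed simp

lemma kauffman_bracket_eq:
  fixes A :: "'a :: field"
  assumes "A \<noteq> 0"
  shows "kauffman_bracket D A = state_sum A (crossings D)
    (\<lambda>R. (- (A powi 2) - A powi (- 2)) ^ (card (points D // glue D R) - 1))"
  unfolding kauffman_bracket_def state_circles_def
  by (rule state_sum_Pow[OF assms])

text \<open>In a state that pairs the four ends there is no closed circle; any other state has a circle
  inside the disc, which later twists keep.\<close>

definition pairing :: "('a \<times> 'a) set \<Rightarrow> 'a set \<Rightarrow> 'a \<Rightarrow> 'a \<Rightarrow> 'a \<Rightarrow> 'a \<Rightarrow> bool" where
  "pairing G P p r q t \<longleftrightarrow> (\<exists>X Y. component G X \<and> component G Y \<and> X \<inter> Y = {} \<and> X \<union> Y = P \<and>
     p \<in> X \<and> r \<in> X \<and> q \<in> Y \<and> t \<in> Y)"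

definition inner_loop :: "('a \<times> 'a) set \<Rightarrow> 'a set \<Rightarrow> 'a set \<Rightarrow> bool" where
  "inner_loop G P B \<longleftrightarrow> (\<exists>X. component G X \<and> X \<subseteq> P \<and> X \<inter> B = {})"

lemma pairing_commute: "pairing G P p r q t \<longleftrightarrow> pairing G P q t p r"
  unfolding pairing_def by blast

lemma pairing_unique:
  assumes "pairing G P p r q t"
  shows "\<not> pairing G P p t q r"
proof
  assume "pairing G P p t q r"
  then obtain X' where X': "component G X'" "p \<in> X'" "t \<in> X'" unfolding pairing_def by blast
  obtain X Y where XY: "component G X" "X \<inter> Y = {}" "p \<in> X" "t \<in> Y"
    using assms unfolding pairing_def by blast
  then show False using component_unique[OF XY(1) X'(1) XY(3) X'(2)] X'(3) by blast
qed

text \<open>The two components of a pairing exhaust \<open>P\<close>, and each of them contains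
  corners.\<close>

lemma pairing_no_inner_loop:
  assumes "pairing G P p r q t"
  shows "\<not> inner_loop G P {p, q, r, t}"
proof
  assume "inner_loop G P {p, q, r, t}"
  then obtain Z where Z: "component G Z" "Z \<subseteq> P" "Z \<inter> {p, q, r, t} = {}"
    unfolding inner_loop_def by blast
  obtain X Y where XY: "component G X" "component G Y" "X \<union> Y = P" "p \<in> X" "t \<in> Y"
    using assms unfolding pairing_def by blast
  obtain z where "z \<in> Z" using Z(1) by (auto simp: component_def)
  then have "Z = X \<or> Z = Y" using XY Z(1,2) component_unique by (metis Un_iff subset_iff)
  then show False using XY Z(3) by auto
qed

section \<open>Effect of a smoothed new crossing on a state of the old tangle\<close>

locale crossing_attached =
  fixes G :: "(nat \<times> nat) set" and P :: "nat set" and p q r t o1 o2 u1 u2 :: nat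
  assumes G: "G \<subseteq> P \<times> P" and corners: "p \<in> P" "q \<in> P" "r \<in> P" "t \<in> P" "distinct [p, q, r, t]"
    and fresh: "{o1, o2, u1, u2} \<inter> P = {}" "distinct [o1, o2, u1, u2]"
begin

definition joined :: "(nat \<times> nat) set" where
  "joined = add_edge t u1 (add_edge p o1 G)"

text \<open>The smoothing that leads across: the ends \<open>p\<close> and \<open>t\<close> are
  prolonged to \<open>u2\<close> and \<open>o2\<close>.\<close>

definition pass :: "(nat \<times> nat) set" where
  "pass = add_edge u1 o2 (add_edge o1 u2 joined)"

text \<open>The smoothing that turns back: \<open>p\<close> and \<open>t\<close> become connected,
  and so do the new corners.\<close>

definition cap :: "(nat \<times> nat) set" where
  "cap = add_edge o2 u2 (add_edge o1 u1 joined)"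

definition P' :: "nat set" where "P' = P \<union> {o1, o2, u1, u2}"

lemma new: "o1 \<notin> P" "o2 \<notin> P" "u1 \<notin> P" "u2 \<notin> P"
    "o1 \<noteq> o2" "o1 \<noteq> u1" "o1 \<noteq> u2" "o2 \<noteq> u1" "o2 \<noteq> u2" "u1 \<noteq> u2"
    "o2 \<noteq> o1" "u1 \<noteq> o1" "u2 \<noteq> o1" "u1 \<noteq> o2" "u2 \<noteq> o2" "u2 \<noteq> u1"
  using fresh by auto

lemma singletons: "component G {o1}" "component G {o2}" "component G {u1}" "component G {u2}"
proof -
  have "y \<notin> Domain G" if "y \<notin> P" for y using G that by blast
  then show "component G {o1}" "component G {o2}" "component G {u1}" "component G {u2}"
    using new(1-4) by (simp_all add: component_singleton)
qed

lemma outside: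
  assumes "X \<subseteq> P"
  shows "o1 \<notin> X" "o2 \<notin> X" "u1 \<notin> X" "u2 \<notin> X"
  using assms new(1-4) by auto

lemma corners_new: "p \<noteq> t" "p \<noteq> o1" "p \<noteq> o2" "p \<noteq> u1" "p \<noteq> u2" "t \<noteq> o1" "t \<noteq> o2" "t \<noteq> u1" "t \<noteq> u2"
  using corners new by auto

lemma joined_singletons: "component joined {o2}" "component joined {u2}"
  unfolding joined_def using singletons new corners_new by (simp_all add: component_keep)

lemma inner_loop_extend:
  assumes "inner_loop G P {p, q, r, t}"
  shows "inner_loop pass P' {u2, q, r, o2}" "inner_loop cap P' {u2, q, r, o2}"
proof -
  obtain Z where Z: "component G Z" "Z \<subseteq> P" "Z \<inter> {p, q, r, t} = {}"
    using assms unfolding inner_loop_def by blast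
  have "component pass Z" "component cap Z"
    unfolding pass_def cap_def joined_def using Z(1,3) outside[OF Z(2)] by (simp_all add: component_keep)
  moreover have "Z \<subseteq> P'" "Z \<inter> {u2, q, r, o2} = {}"
    using Z(2,3) outside[OF Z(2)] unfolding P'_def by auto
  ultimately show "inner_loop pass P' {u2, q, r, o2}" "inner_loop cap P' {u2, q, r, o2}"
    unfolding inner_loop_def by blast+
qed

text \<open>With \<open>cap\<close>, the two old strands are linked through \<open>o1\<close> and
  \<open>u1\<close> into one strand from \<open>q\<close> to \<open>r\<close>, and
  \<open>u2\<close>, \<open>o2\<close> form a strand of their own.\<close>

lemma pairing_pr_extend:
  assumes "pairing G P p r q t"
  shows "pairing pass P' u2 r q o2" "pairing cap P' u2 o2 q r"
proof -
  obtain X Y where XY: "component G X" "component G Y" "X \<inter> Y = {}" "X \<union> Y = P"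
     "p \<in> X" "r \<in> X" "q \<in> Y" "t \<in> Y" using assms unfolding pairing_def by blast
  have tp: "t \<notin> X" "p \<notin> Y" using XY by auto
  have "X \<subseteq> P" "Y \<subseteq> P" using XY by auto
  note n = outside[OF this(1)] outside[OF this(2)]
  have "component (add_edge p o1 G) (insert o1 X)" "component (add_edge p o1 G) Y"
    "component (add_edge p o1 G) {u1}"
    using XY singletons n new tp corners_new by (simp_all add: component_insert component_keep)
  then have j: "component joined (insert o1 X)" "component joined (insert u1 Y)"
    unfolding joined_def using XY n new tp corners_new
    by (simp_all add: component_insert component_keep)
  have "component (add_edge o1 u2 joined) (insert u2 (insert o1 X))"
    "component (add_edge o1 u2 joined) (insert u1 Y)" "component (add_edge o1 u2 joined) {o2}"
    using j joined_singletons n new by (simp_all add: component_insert component_keep)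
  then have pass: "component pass (insert u2 (insert o1 X))" "component pass (insert o2 (insert u1 Y))"
    unfolding pass_def using n new by (simp_all add: component_insert component_keep)
  have "component (add_edge o1 u1 joined) (insert o1 X \<union> insert u1 Y)"
    "component (add_edge o1 u1 joined) {o2}" "component (add_edge o1 u1 joined) {u2}"
    using component_merge[OF j, of o1 u1] joined_singletons new by (simp_all add: component_keep)
  then have cap: "component cap (insert o1 X \<union> insert u1 Y)" "component cap {u2, o2}"
    unfolding cap_def using n new by (simp_all add: component_insert component_keep)
  show "pairing pass P' u2 r q o2"
    unfolding pairing_def
    by (rule exI[of _ "insert u2 (insert o1 X)"], rule exI[of _ "insert o2 (insert u1 Y)"])
      (use pass XY n new in \<open>auto simp: P'_def\<close>)
  show "pairing cap P' u2 o2 q r"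
    unfolding pairing_def
    by (rule exI[of _ "{u2, o2}"], rule exI[of _ "insert o1 X \<union> insert u1 Y"])
      (use cap XY n new in \<open>auto simp: P'_def\<close>)
qed

text \<open>With \<open>cap\<close>, the old strand from \<open>p\<close> to \<open>t\<close> is
  closed into a circle. This is the only way in which a loop is born.\<close>

lemma pairing_pt_extend:
  assumes "pairing G P p t q r"
  shows "pairing pass P' u2 o2 q r" "inner_loop cap P' {u2, q, r, o2}"
proof -
  obtain X Y where XY: "component G X" "component G Y" "X \<inter> Y = {}" "X \<union> Y = P"
     "p \<in> X" "t \<in> X" "q \<in> Y" "r \<in> Y" using assms unfolding pairing_def by blast
  have tp: "t \<notin> Y" "p \<notin> Y" "q \<notin> X" "r \<notin> X" using XY by auto
  have "X \<subseteq> P" "Y \<subseteq> P" using XY by auto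
  note n = outside[OF this(1)] outside[OF this(2)]
  let ?X = "insert u1 (insert o1 X)"
  have "component (add_edge p o1 G) (insert o1 X)" "component (add_edge p o1 G) Y"
    "component (add_edge p o1 G) {u1}"
    using XY singletons n new tp corners_new by (simp_all add: component_insert component_keep)
  then have j: "component joined ?X" "component joined Y"
    unfolding joined_def using XY n new tp corners_new
    by (simp_all add: component_insert component_keep)
  have "component (add_edge o1 u2 joined) (insert u2 ?X)"
    "component (add_edge o1 u2 joined) Y" "component (add_edge o1 u2 joined) {o2}"
    using j joined_singletons n new by (simp_all add: component_insert component_keep)
  then have pass: "component pass (insert o2 (insert u2 ?X))" "component pass Y"
    unfolding pass_def using n new by (simp_all add: component_insert component_keep)
  have "component (add_edge o1 u1 joined) ?X"
    using j by (simp add: component_inside)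
  then have cap: "component cap ?X"
    unfolding cap_def using n new by (simp add: component_keep)
  show "pairing pass P' u2 o2 q r"
    unfolding pairing_def
    by (rule exI[of _ "insert o2 (insert u2 ?X)"], rule exI[of _ Y])
      (use pass XY n new in \<open>auto simp: P'_def\<close>)
  show "inner_loop cap P' {u2, q, r, o2}"
    unfolding inner_loop_def
    by (rule exI[of _ ?X]) (use cap XY tp n new corners in \<open>auto simp: P'_def\<close>)
qed

end

lemma twist_crossing_corners:
  "twist_crossing c w o1 o2 u1 u2 \<Longrightarrow> {nw c, ne c, sw c, se c} = {o1, o2, u1, u2}"
  by (auto simp: twist_crossing_def over_ends_def under_ends_def split: if_splits)

lemma alternating_twist_crossings:
  "alternating_twist w P cs E p q r t a b \<Longrightarrow> c \<in> set cs \<Longrightarrow> {nw c, ne c, sw c, se c} \<subseteq> P"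
proof (induction rule: alternating_twist.induct)
  case (attach w P cs E p q r t a b d o1 o2 u1 u2 cs' P' E')
  then have "c = d \<or> c \<in> set cs" by auto
  then show ?case
    using attach.IH twist_crossing_corners[OF attach.hyps(3)] unfolding attach.hyps(7) by blast
qed simp_all

lemma states_subset:
  assumes "\<And>c. c \<in> set cs \<Longrightarrow> {nw c, ne c, sw c, se c} \<subseteq> P" "R \<in> states cs"
  shows "R \<subseteq> P \<times> P"
  using assms
proof (induction cs arbitrary: R)
  case (Cons c cs)
  obtain R' z where R': "R' \<in> states cs" "R = R' \<union> smoothing z c" using Cons.prems(2) by auto
  have "R' \<subseteq> P \<times> P" using Cons.IH[OF _ R'(1)] Cons.prems(1) by simp
  moreover have "smoothing z c \<subseteq> P \<times> P" using Cons.prems(1)[of c] by (simp add: smoothing_def)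
  ultimately show ?case using R'(2) by simp
qed simp

lemma alternating_twist_attached:
  assumes "alternating_twist w P cs E p q r t a b" "twist_crossing c w o1 o2 u1 u2"
    "distinct [o1, o2, u1, u2]" "{o1, o2, u1, u2} \<inter> P = {}" "R \<in> states cs"
  defines "E' \<equiv> E \<union> sym_closure {(p, o1), (t, u1)}"
  shows "crossing_attached (E \<union> sym_closure R) P p q r t o1 o2 u1 u2"
    "E' \<union> sym_closure (R \<union> smoothing (over_NW_SE c = w) c) =
      crossing_attached.pass (E \<union> sym_closure R) p t o1 o2 u1 u2"
    "E' \<union> sym_closure (R \<union> smoothing (over_NW_SE c \<noteq> w) c) =
      crossing_attached.cap (E \<union> sym_closure R) p t o1 o2 u1 u2"
proof -
  note wf = alternating_twist_wf[OF assms(1)]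
  have R: "sym_closure R \<subseteq> P \<times> P"
    using states_subset[OF alternating_twist_crossings[OF assms(1)] assms(5)]
    by (rule sym_closure_subset)
  show loc: "crossing_attached (E \<union> sym_closure R) P p q r t o1 o2 u1 u2"
    using wf R assms(3,4) by unfold_locales auto
  have s: "sym_closure (smoothing (over_NW_SE c = w) c) = sym_closure {(o1, u2), (u1, o2)}"
    "sym_closure (smoothing (over_NW_SE c \<noteq> w) c) = sym_closure {(o1, u1), (o2, u2)}"
    using assms(2) by (simp_all add: twist_crossing_def)
  show "E' \<union> sym_closure (R \<union> smoothing (over_NW_SE c = w) c) =
      crossing_attached.pass (E \<union> sym_closure R) p t o1 o2 u1 u2"
    unfolding crossing_attached.pass_def[OF loc] crossing_attached.joined_def[OF loc] E'_def
      sym_closure_Un s add_edge_def by (simp add: sym_closure_insert insert_commute)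
  show "E' \<union> sym_closure (R \<union> smoothing (over_NW_SE c \<noteq> w) c) =
      crossing_attached.cap (E \<union> sym_closure R) p t o1 o2 u1 u2"
    unfolding crossing_attached.cap_def[OF loc] crossing_attached.joined_def[OF loc] E'_def
      sym_closure_Un s add_edge_def by (simp add: sym_closure_insert insert_commute)
qed

lemma alternating_twist_attach_states:
  assumes "alternating_twist w P cs E p q r t a b" "twist_crossing c w o1 o2 u1 u2"
    "distinct [o1, o2, u1, u2]" "{o1, o2, u1, u2} \<inter> P = {}" "R \<in> states cs"
  defines "E' \<equiv> E \<union> sym_closure {(p, o1), (t, u1)}" and "P' \<equiv> P \<union> {o1, o2, u1, u2}"
  defines "G \<equiv> E \<union> sym_closure R"
    and "G1 \<equiv> E' \<union> sym_closure (R \<union> smoothing (over_NW_SE c = w) c)"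
    and "G2 \<equiv> E' \<union> sym_closure (R \<union> smoothing (over_NW_SE c \<noteq> w) c)"
  shows "pairing G P p r q t \<Longrightarrow> pairing G1 P' u2 r q o2"
    "pairing G P p r q t \<Longrightarrow> pairing G2 P' u2 o2 q r"
    "pairing G P p t q r \<Longrightarrow> pairing G1 P' u2 o2 q r"
    "pairing G P p t q r \<Longrightarrow> inner_loop G2 P' {u2, q, r, o2}"
    "inner_loop G P {p, q, r, t} \<Longrightarrow> inner_loop G1 P' {u2, q, r, o2}"
    "inner_loop G P {p, q, r, t} \<Longrightarrow> inner_loop G2 P' {u2, q, r, o2}"
proof -
  note at = alternating_twist_attached[OF assms(1-5), folded E'_def G_def, folded G1_def G2_def]
  note loc = at(1)
  have P': "P' = crossing_attached.P' P o1 o2 u1 u2"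
    by (simp add: P'_def crossing_attached.P'_def[OF loc])
  note ext = crossing_attached.pairing_pr_extend[OF loc] crossing_attached.pairing_pt_extend[OF loc]
    crossing_attached.inner_loop_extend[OF loc]
  show "pairing G P p r q t \<Longrightarrow> pairing G1 P' u2 r q o2"
    "pairing G P p r q t \<Longrightarrow> pairing G2 P' u2 o2 q r"
    "pairing G P p t q r \<Longrightarrow> pairing G1 P' u2 o2 q r"
    "pairing G P p t q r \<Longrightarrow> inner_loop G2 P' {u2, q, r, o2}"
    "inner_loop G P {p, q, r, t} \<Longrightarrow> inner_loop G1 P' {u2, q, r, o2}"
    "inner_loop G P {p, q, r, t} \<Longrightarrow> inner_loop G2 P' {u2, q, r, o2}"
    unfolding at(2,3) P' by (fact ext)+
qed

text \<open>The crossed pairing of \<open>p\<close> with \<open>q\<close> never appears, because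
  smoothings join neighboring corners only; the extension rules for the two smoothings lead from
  these three cases back to them.\<close>

lemma alternating_twist_states:
  "alternating_twist w P cs E p q r t a b \<Longrightarrow> R \<in> states cs \<Longrightarrow>
    pairing (E \<union> sym_closure R) P p r q t \<or> pairing (E \<union> sym_closure R) P p t q r \<or>
    inner_loop (E \<union> sym_closure R) P {p, q, r, t}"
proof (induction arbitrary: R rule: alternating_twist.induct)
  case (base p q r t P E w)
  have E: "E = add_edge q t (add_edge p r {})"
    unfolding base add_edge_def by (auto simp: sym_closure_insert)
  have s: "component {} {x}" for x :: nat by (simp add: component_singleton)
  have ne: "p \<noteq> q" "p \<noteq> t" "r \<noteq> q" "r \<noteq> t" using base(1) by auto
  have "component (add_edge p r {}) {r, p}" "component (add_edge p r {}) {q}" "component (add_edge p r {}) {t}"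
    using s ne by (simp_all add: component_insert component_keep)
  then have "component E {r, p}" "component E {t, q}"
    unfolding E using ne by (simp_all add: component_insert component_keep)
  then have "pairing E P p r q t"
    unfolding pairing_def base(2) using ne by (intro exI[of _ "{r, p}"] exI[of _ "{t, q}"]) auto
  then show ?case using base by simp
next
  case (flip w P cs E p q r t a b)
  have "{q, p, t, r} = {p, q, r, t}" by auto
  then show ?case
    using flip.IH[OF flip.prems] pairing_commute[of "E \<union> sym_closure R" P] by metis
next
  case (switch w P cs E p q r t a b)
  have "{p, q, t, r} = {p, q, r, t}" by auto
  then show ?case using switch.IH[OF switch.prems] by metis
next
  case (attach w P cs E p q r t a b c o1 o2 u1 u2 cs' P' E')
  have "states cs' = states (c # cs)"
    using attach.hyps(6) by (auto simp only: insert_iff empty_iff states_snoc)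
  then obtain R' z where R': "R' \<in> states cs" "R = R' \<union> smoothing z c"
    using attach.prems by auto
  note ext = attach.IH[OF R'(1)]
    alternating_twist_attach_states[OF attach.hyps(1,3,4,5) R'(1), folded attach.hyps(7,8)]
  have "z = (over_NW_SE c = w) \<or> z = (over_NW_SE c \<noteq> w)" by blast
  then show ?case
  proof
    assume z: "z = (over_NW_SE c = w)"
    show ?case unfolding R'(2) z using ext by argo
  next
    assume z: "z = (over_NW_SE c \<noteq> w)"
    show ?case unfolding R'(2) z using ext by argo
  qed
qed

text \<open>\<open>A1\<close> and \<open>A2\<close> are the weights of leading across and of turning
  back. Of the four combinations of an old pairing with a smoothing, one produces a loop and is
  lost, one feeds the first new sum, and two feed the second; hence the weights go from
  \<open>a\<close>, \<open>b\<close> to \<open>a\<close>, \<open>a + b\<close>.\<close>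

lemma state_sum_attach:
  fixes A :: "'a :: field"
  assumes "alternating_twist w P cs E p q r t a b" "twist_crossing c w o1 o2 u1 u2"
    "distinct [o1, o2, u1, u2]" "{o1, o2, u1, u2} \<inter> P = {}" "cs' \<in> {c # cs, cs @ [c]}"
    "P' = P \<union> {o1, o2, u1, u2}" "E' = E \<union> sym_closure {(p, o1), (t, u1)}"
  defines "N \<equiv> \<lambda>r t. state_sum A cs (\<lambda>R. of_bool (pairing (E \<union> sym_closure R) P p r q t))"
    and "N' \<equiv> \<lambda>r t. state_sum A cs' (\<lambda>R. of_bool (pairing (E' \<union> sym_closure R) P' u2 r q t))"
    and "A1 \<equiv> (if w then A else inverse A)" and "A2 \<equiv> (if w then inverse A else A)"
  shows "N' r o2 = A1 * N r t" "N' o2 r = A1 * N t r + A2 * N r t"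
proof -
  let ?s1 = "smoothing (over_NW_SE c = w) c" and ?s2 = "smoothing (over_NW_SE c \<noteq> w) c"
  have expand: "state_sum A cs' h =
      A1 * state_sum A cs (\<lambda>R. h (R \<union> ?s1)) + A2 * state_sum A cs (\<lambda>R. h (R \<union> ?s2))" for h
  proof -
    have "state_sum A cs' h = state_sum A (c # cs) h" using assms(5) state_sum_snoc by auto
    then show ?thesis unfolding A1_def A2_def by (cases w) (simp_all add: add.commute)
  qed
  let ?G = "\<lambda>R. E \<union> sym_closure R"
  let ?G1 = "\<lambda>R. E' \<union> sym_closure (R \<union> ?s1)" and ?G2 = "\<lambda>R. E' \<union> sym_closure (R \<union> ?s2)"
  note ext = alternating_twist_attach_states[OF assms(1-4), folded assms(6,7)]
  have corners: "{u2, r, q, o2} = {u2, q, r, o2}" "{u2, q, o2, r} = {u2, q, r, o2}"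
    and cornersG: "{p, q, t, r} = {p, q, r, t}" by auto
  have excl: "\<not> pairing G P' u2 o2 q r" "\<not> inner_loop G P' {u2, q, r, o2}" if "pairing G P' u2 r q o2" for G
    using that pairing_unique pairing_no_inner_loop by metis+
  have excl': "\<not> pairing G P' u2 r q o2" "\<not> inner_loop G P' {u2, q, r, o2}" if "pairing G P' u2 o2 q r" for G
    using that pairing_unique pairing_no_inner_loop corners by metis+
  have exclG: "pairing (?G R) P p r q t \<Longrightarrow> \<not> pairing (?G R) P p t q r \<and> \<not> inner_loop (?G R) P {p, q, r, t}"
    "pairing (?G R) P p t q r \<Longrightarrow> \<not> inner_loop (?G R) P {p, q, r, t}" for R
    using pairing_unique[of "?G R" P p r q t] pairing_no_inner_loop[of "?G R" P p r q t]
      pairing_no_inner_loop[of "?G R" P p t q r] cornersG by simp_all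
  \<comment> \<open>The three possible outcomes exclude each other, before and after attaching, so
    the implications of \<open>ext\<close> become equivalences.\<close>
  have table: "pairing (?G1 R) P' u2 r q o2 \<longleftrightarrow> pairing (?G R) P p r q t"
    "pairing (?G1 R) P' u2 o2 q r \<longleftrightarrow> pairing (?G R) P p t q r"
    "\<not> pairing (?G2 R) P' u2 r q o2"
    "pairing (?G2 R) P' u2 o2 q r \<longleftrightarrow> pairing (?G R) P p r q t" if R: "R \<in> states cs" for R
    using alternating_twist_states[OF assms(1) R] ext[OF R] excl[of "?G1 R"] excl[of "?G2 R"]
      excl'[of "?G1 R"] excl'[of "?G2 R"] exclG[of R] by argo+
  have "state_sum A cs (\<lambda>R. of_bool (pairing (?G1 R) P' u2 r q o2)) = N r t"
    "state_sum A cs (\<lambda>R. of_bool (pairing (?G1 R) P' u2 o2 q r)) = N t r"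
    "state_sum A cs (\<lambda>R. of_bool (pairing (?G2 R) P' u2 o2 q r)) = N r t"
    unfolding N_def by (rule state_sum_cong, simp only: table)+
  moreover have "state_sum A cs (\<lambda>R. of_bool (pairing (?G2 R) P' u2 r q o2)) = state_sum A cs (\<lambda>R. 0)"
    by (rule state_sum_cong, simp only: table of_bool_eq)
  ultimately show "N' r o2 = A1 * N r t" "N' o2 r = A1 * N t r + A2 * N r t"
    unfolding N'_def expand by (simp_all add: state_sum_zero)
qed

section \<open>Evaluation at the square root of \<i> and the determinant\<close>

declare csqrt_ii [simp del]

lemma csqrt_i: "cmod (csqrt \<i>) = 1" "csqrt \<i> \<noteq> 0" "inverse (csqrt \<i>) = - \<i> * csqrt \<i>"
proof -
  have sq: "csqrt \<i> * csqrt \<i> = \<i>" by (metis power2_csqrt power2_eq_square)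
  have "(cmod (csqrt \<i>))\<^sup>2 = 1" by (metis norm_ii norm_power power2_csqrt)
  then show norm: "cmod (csqrt \<i>) = 1" using power2_eq_imp_eq[of "cmod (csqrt \<i>)" 1] by simp
  show "csqrt \<i> \<noteq> 0" using norm by (metis norm_zero zero_neq_one)
  have "csqrt \<i> * (- \<i> * csqrt \<i>) = - \<i> * (csqrt \<i> * csqrt \<i>)" by (simp only: mult_ac)
  also have "\<dots> = 1" unfolding sq by simp
  finally show "inverse (csqrt \<i>) = - \<i> * csqrt \<i>" by (rule inverse_unique)
qed

text \<open>Both sums have a constant phase because of \<open>A\<^sup>2 = \<i>\<close>; the phases differ by a quarter turn,
  which an exchange of \<open>A\<close> and its inverse in the recursion compensates.\<close>

lemma alternating_twist_state_sum:
  fixes a b :: int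
  shows "alternating_twist w P cs E p q r t a b \<Longrightarrow> \<exists>u. cmod u = 1 \<and>
    state_sum (csqrt \<i>) cs (\<lambda>R. of_bool (pairing (E \<union> sym_closure R) P p r q t)) =
      (if w then u else - \<i> * u) * of_int a \<and>
    state_sum (csqrt \<i>) cs (\<lambda>R. of_bool (pairing (E \<union> sym_closure R) P p t q r)) =
      (if w then - \<i> * u else u) * of_int b"
proof (induction rule: alternating_twist.induct)
  case (base p q r t P E w)
  have *: "alternating_twist w P [] E p q r t 1 0" using base by (rule alternating_twist.base)
  have "\<not> inner_loop E P {p, q, r, t}"
  proof
    assume "inner_loop E P {p, q, r, t}"
    then obtain X where "X \<noteq> {}" "X \<subseteq> P" "X \<inter> {p, q, r, t} = {}"
      unfolding inner_loop_def component_def by blast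
    then show False unfolding base(2) by blast
  qed
  moreover have "\<not> pairing E P p t q r"
  proof
    assume "pairing E P p t q r"
    then obtain X Y where X: "component E X" "p \<in> X" "X \<inter> Y = {}" "r \<in> Y"
      unfolding pairing_def by blast
    have "(p, r) \<in> E" unfolding base(3) by (simp add: sym_closure_insert)
    then show False using X unfolding component_def by blast
  qed
  ultimately have "pairing E P p r q t" "\<not> pairing E P p t q r"
    using alternating_twist_states[OF *, of "{}"] by auto
  \<comment> \<open>The only state has value 1, and \<open>- \<i> * \<i> = 1\<close> accounts for
    the witness when \<open>w\<close> is false.\<close>
  then show ?case by (intro exI[of _ "if w then 1 else \<i>"]) simp
next
  case (flip w P cs E p q r t a b)
  then show ?case by (simp add: pairing_commute[of _ _ q])
next
  case (switch w P cs E p q r t a b)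
  then show ?case by auto
next
  case (attach w P cs E p q r t a b c o1 o2 u1 u2 cs' P' E')
  note step = state_sum_attach[OF attach.hyps(1,3-8), of "csqrt \<i>"]
  obtain u where u: "cmod u = 1"
    "state_sum (csqrt \<i>) cs (\<lambda>R. of_bool (pairing (E \<union> sym_closure R) P p r q t)) =
      (if w then u else - \<i> * u) * of_int a"
    "state_sum (csqrt \<i>) cs (\<lambda>R. of_bool (pairing (E \<union> sym_closure R) P p t q r)) =
      (if w then - \<i> * u else u) * of_int b"
    using attach.IH by blast
  \<comment> \<open>The phase is multiplied by the weight of leading across. As
    \<open>inverse A = - \<i> * A\<close>, the two contributions to the second sum are in phase, so
    their integer factors add up to \<open>a + b\<close> without cancellation.\<close>
  let ?u = "(if w then csqrt \<i> else inverse (csqrt \<i>)) * u"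
  have "cmod ?u = 1" using u(1) csqrt_i(1) by (simp add: norm_mult norm_inverse)
  then show ?case
    unfolding step u(2,3)
    by (intro exI[of _ ?u]) (simp add: csqrt_i(3) algebra_simps)
qed

lemma card_quotient_ge_2:
  assumes "finite P" "component H X" "X \<subseteq> P" "p \<in> P" "p \<notin> X"
  shows "2 \<le> card (P // H\<^sup>*)"
proof -
  have fin: "finite (P // H\<^sup>*)" unfolding quotient_def using assms(1) by simp
  obtain x where "x \<in> X" using assms(2) by (auto simp: component_def)
  then have "X \<in> P // H\<^sup>*" using component_quotient[OF assms(2)] assms(3) by auto
  moreover have "H\<^sup>* `` {p} \<in> P // H\<^sup>*" using assms(4) by (rule quotientI)
  moreover have "X \<noteq> H\<^sup>* `` {p}" using assms(5) by auto
  ultimately have "{X, H\<^sup>* `` {p}} \<subseteq> P // H\<^sup>*" "card {X, H\<^sup>* `` {p}} = 2" by auto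
  then show ?thesis using card_mono[OF fin] by metis
qed

text \<open>The closing curves join \<open>p\<close> to \<open>r\<close> and \<open>q\<close> to
  \<open>t\<close>. A state with the pairing \<open>p-r\<close>, \<open>q-t\<close> thus closes to
  two circles, one with the pairing \<open>p-t\<close>, \<open>q-r\<close> to a single circle, and a
  loop inside always gives a second circle. What survives is the sum belonging to
  \<open>b\<close>.\<close>

lemma determinant_closure:
  assumes tw: "alternating_twist w P cs E p q r t a b"
    and D: "points D = P" "crossings D = cs" "sym_closure (joins D) = E \<union> sym_closure {(p, r), (q, t)}"
  shows "determinant D = of_int b"
proof -
  let ?A = "csqrt \<i>"
  note wf = alternating_twist_wf[OF tw]
  have fin: "finite P" and inP: "p \<in> P" "q \<in> P" "r \<in> P" "t \<in> P" using wf by auto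
  have delta: "- (?A powi 2) - ?A powi (- 2) = 0"
    by (simp add: power_int_minus)
  let ?G = "\<lambda>R. E \<union> sym_closure R"
  let ?H = "\<lambda>R. add_edge q t (add_edge p r (?G R))"
  have glue: "glue D R = (?H R)\<^sup>*" for R
    unfolding glue_eq D add_edge_def by (rule arg_cong[where f = rtrancl]) (simp add: sym_closure_insert insert_commute)
  \<comment> \<open>The exponent is the number of circles minus one, so \<open>0 ^ 0 = 1\<close>
    selects the states with exactly one circle.\<close>
  have circles: "0 ^ (card (points D // glue D R) - 1) =
      (of_bool (pairing (?G R) P p t q r) :: complex)" if R: "R \<in> states cs" for R
  proof -
    consider (pr) "pairing (?G R) P p r q t" | (pt) "pairing (?G R) P p t q r"
      | (loop) "inner_loop (?G R) P {p, q, r, t}" using alternating_twist_states[OF tw R] by blast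
    then show ?thesis
    proof cases
      case pr
      then obtain X Y where XY: "component (?G R) X" "component (?G R) Y" "X \<inter> Y = {}" "X \<union> Y = P"
        "p \<in> X" "r \<in> X" "q \<in> Y" "t \<in> Y" unfolding pairing_def by blast
      then have "component (?H R) X" by (intro component_keep component_inside) auto
      moreover have "X \<subseteq> P" "q \<in> P" "q \<notin> X" using XY by auto
      ultimately have "2 \<le> card (points D // glue D R)"
        unfolding glue D using card_quotient_ge_2[OF fin] by blast
      then show ?thesis using pairing_unique[OF pr] by simp
    next
      case pt
      then obtain X Y where XY: "component (?G R) X" "component (?G R) Y" "X \<inter> Y = {}" "X \<union> Y = P"
        "p \<in> X" "t \<in> X" "q \<in> Y" "r \<in> Y" unfolding pairing_def by blast
      then have "component (add_edge p r (?G R)) P" using component_merge by metis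
      then have H: "component (?H R) P" using inP(2,4) by (rule component_inside)
      have "P // (?H R)\<^sup>* = {P}"
        using component_class[OF H] inP(1) unfolding quotient_def by auto
      then show ?thesis using pt unfolding glue D by simp
    next
      case loop
      then obtain X where X: "component (?G R) X" "X \<subseteq> P" "X \<inter> {p, q, r, t} = {}"
        unfolding inner_loop_def by blast
      then have "component (?H R) X" by (intro component_keep) auto
      moreover have "p \<notin> X" using X by auto
      ultimately have "2 \<le> card (points D // glue D R)"
        unfolding glue D using card_quotient_ge_2[OF fin _ X(2) inP(1)] by blast
      moreover have "\<not> pairing (?G R) P p t q r"
        using loop pairing_no_inner_loop by (metis insert_commute)
      ultimately show ?thesis by simp
    qed
  qed
  have "kauffman_bracket D ?A = state_sum ?A cs (\<lambda>R. of_bool (pairing (?G R) P p t q r))"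
    unfolding kauffman_bracket_eq[OF csqrt_i(2)] delta D(2) by (rule state_sum_cong) (rule circles)
  moreover obtain u where "cmod u = 1" "state_sum ?A cs (\<lambda>R. of_bool (pairing (?G R) P p t q r)) =
      (if w then - \<i> * u else u) * of_int b"
    using alternating_twist_state_sum[OF tw] by blast
  ultimately have "determinant D = \<bar>of_int b\<bar>"
    unfolding determinant_def by (auto simp: norm_mult)
  then show ?thesis using wf by simp
qed

text \<open>Together with \<open>attach\<close> and the next two lemmas, this covers the four sides
  of the quadrilateral. \<open>flip\<close> reaches the opposite side; \<open>switch\<close> reaches
  the adjacent sides, where the weights exchange roles and the crossing is read with the opposite
  flag.\<close>

lemma alternating_twist_attach_qr:
  assumes "alternating_twist w P cs E p q r t a b" "0 < a" "twist_crossing c w o1 o2 u1 u2"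
    "distinct [o1, o2, u1, u2]" "{o1, o2, u1, u2} \<inter> P = {}" "cs' \<in> {c # cs, cs @ [c]}"
    "P' = P \<union> {o1, o2, u1, u2}" "E' = E \<union> sym_closure {(q, o1), (r, u1)}"
  shows "alternating_twist w P' cs' E' p u2 o2 t a (a + b)"
  by (rule alternating_twist.flip, rule alternating_twist.attach[OF alternating_twist.flip]) (fact assms)+

lemma alternating_twist_attach_pr:
  assumes "alternating_twist w P cs E p q r t a b" "0 < b" "twist_crossing c w' o1 o2 u1 u2"
    "distinct [o1, o2, u1, u2]" "{o1, o2, u1, u2} \<inter> P = {}" "cs' \<in> {c # cs, cs @ [c]}"
    "P' = P \<union> {o1, o2, u1, u2}" "E' = E \<union> sym_closure {(p, o1), (r, u1)}" "w' = (\<not> w)"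
  shows "alternating_twist w P' cs' E' u2 q o2 t (b + a) b"
  using alternating_twist.switch[OF alternating_twist.attach[OF
      alternating_twist.switch[OF assms(1)] assms(2) assms(3)[unfolded assms(9)] assms(4-8)]]
  by simp

lemma alternating_twist_attach_qt:
  assumes "alternating_twist w P cs E p q r t a b" "0 < b" "twist_crossing c w' o1 o2 u1 u2"
    "distinct [o1, o2, u1, u2]" "{o1, o2, u1, u2} \<inter> P = {}" "cs' \<in> {c # cs, cs @ [c]}"
    "P' = P \<union> {o1, o2, u1, u2}" "E' = E \<union> sym_closure {(q, o1), (t, u1)}" "w' = (\<not> w)"
  shows "alternating_twist w P' cs' E' p u2 r o2 (b + a) b"
  by (rule alternating_twist.flip, rule alternating_twist_attach_pr[OF alternating_twist.flip]) (fact assms)+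

text \<open>For each type of crossing the four placements are listed in the order right, left,
  below, above; \<open>o1\<close> and \<open>u1\<close> are the corners facing the tangle. For the
  vertical placements the flag is negated, since [0] then turns the strands back instead of leading
  them across.\<close>

lemma twist_crossing_Crossing:
  "twist_crossing (Crossing True x1 x2 x3 x4) True x1 x4 x3 x2"
  "twist_crossing (Crossing True x1 x2 x3 x4) True x4 x1 x2 x3"
  "twist_crossing (Crossing True x1 x2 x3 x4) False x1 x4 x2 x3"
  "twist_crossing (Crossing True x1 x2 x3 x4) False x4 x1 x3 x2"
  "twist_crossing (Crossing False x1 x2 x3 x4) False x3 x2 x1 x4"
  "twist_crossing (Crossing False x1 x2 x3 x4) False x2 x3 x4 x1"
  "twist_crossing (Crossing False x1 x2 x3 x4) True x2 x3 x1 x4"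
  "twist_crossing (Crossing False x1 x2 x3 x4) True x3 x2 x4 x1"
  by (simp_all add: twist_crossing_def over_ends_def under_ends_def smoothing_def
      sym_closure_insert insert_commute)

lemma alternating_twist_empty:
  "alternating_twist w P cs E p q r t a b \<Longrightarrow> cs = [] \<Longrightarrow>
    a = 1 \<and> b = 0 \<and> {(p, r), (r, p), (q, t), (t, q)} \<subseteq> E \<or>
    a = 0 \<and> b = 1 \<and> {(p, t), (t, p), (q, r), (r, q)} \<subseteq> E"
proof (induction rule: alternating_twist.induct)
  case base
  then show ?case by (simp add: sym_closure_insert)
qed auto

abbreviation over_set :: "crossing list \<Rightarrow> nat set" where
  "over_set cs \<equiv> (\<Union>c\<in>set cs. {fst (over_ends c), snd (over_ends c)})"

abbreviation under_set :: "crossing list \<Rightarrow> nat set" where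
  "under_set cs \<equiv> (\<Union>c\<in>set cs. {fst (under_ends c), snd (under_ends c)})"

text \<open>The new corners \<open>u2\<close> and \<open>o2\<close> are themselves an under end and
  an over end, and the other corners keep the passages they had. In an alternating diagram this
  determines the type of the next crossing.\<close>

lemma alternating_twist_corner_ends:
  "alternating_twist w P cs E p q r t a b \<Longrightarrow> cs \<noteq> [] \<Longrightarrow>
    (\<exists>x\<in>under_set cs. (p, x) \<in> E\<^sup>*) \<and> (\<exists>x\<in>under_set cs. (q, x) \<in> E\<^sup>*) \<and>
    (\<exists>x\<in>over_set cs. (r, x) \<in> E\<^sup>*) \<and> (\<exists>x\<in>over_set cs. (t, x) \<in> E\<^sup>*)"
proof (induction rule: alternating_twist.induct)
  case (attach w P cs E p q r t a b c o1 o2 u1 u2 cs' P' E')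
  have set_cs': "set cs' = insert c (set cs)" using attach.hyps(6) by auto
  have ends: "over_ends c \<in> {(o1, o2), (o2, o1)}" "under_ends c \<in> {(u1, u2), (u2, u1)}"
    using attach.hyps(3) by (simp_all add: twist_crossing_def)
  then have U: "under_set cs' = {u1, u2} \<union> under_set cs" and O: "over_set cs' = {o1, o2} \<union> over_set cs"
    unfolding set_cs' by auto
  have mono: "E\<^sup>* \<subseteq> E'\<^sup>*" unfolding attach.hyps(8) by (rule rtrancl_mono) simp
  have "(\<exists>x\<in>under_set cs'. (q, x) \<in> E'\<^sup>*) \<and> (\<exists>x\<in>over_set cs'. (r, x) \<in> E'\<^sup>*)"
  \<comment> \<open>Without crossings \<open>q\<close> and \<open>r\<close> have no passage of their
    own yet; \<open>0 < a\<close> leaves the arcs \<open>p-r\<close> and \<open>q-t\<close>, which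
    lead \<open>r\<close> to \<open>o1\<close> and \<open>q\<close> to \<open>u1\<close>.\<close>
  proof (cases "cs = []")
    case True
    then have "(r, p) \<in> E" "(q, t) \<in> E"
      using alternating_twist_empty[OF attach.hyps(1) True] \<open>0 < a\<close> by auto
    then have "(r, p) \<in> E'" "(q, t) \<in> E'" "(p, o1) \<in> E'" "(t, u1) \<in> E'"
      unfolding attach.hyps(8) by (simp_all add: sym_closure_insert)
    then have "(r, o1) \<in> E'\<^sup>*" "(q, u1) \<in> E'\<^sup>*"
      by (meson r_into_rtrancl rtrancl_into_rtrancl)+
    then show ?thesis unfolding U O by blast
  next
    case False
    then show ?thesis using attach.IH mono unfolding U O by blast
  qed
  then show ?case unfolding U O by blast
qed auto

section \<open>Twisting operations\<close>

definition wf_tangle :: "tangle \<Rightarrow> bool" where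
  "wf_tangle T \<longleftrightarrow> {NW T, NE T, SW T, SE T} \<subseteq> points T \<and> joins T \<subseteq> points T \<times> points T \<and>
     (\<forall>c\<in>set (crossings T). {nw c, ne c, sw c, se c} \<subseteq> points T)"

text \<open>One of the four twisting operations: \<open>T\<close> is renumbered by \<open>k\<close>, and \<open>F\<close> joins it to the
  new crossing \<open>c\<close>.\<close>

definition twisting :: "nat \<Rightarrow> tangle \<Rightarrow> crossing \<Rightarrow> (nat \<times> nat) set \<Rightarrow> tangle \<Rightarrow> bool" where
  "twisting k T c F T' \<longleftrightarrow> (let V = {nw c, ne c, sw c, se c}; B = (+) k ` {NW T, NE T, SW T, SE T} in
     points T' = (+) k ` points T \<union> V \<and> V \<inter> (+) k ` points T = {} \<and>
     crossings T' \<in> {c # map (shift_crossing k) (crossings T), map (shift_crossing k) (crossings T) @ [c]} \<and>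
     joins T' = map_prod ((+) k) ((+) k) ` joins T \<union> F \<and>
     F \<subseteq> (B \<union> V) \<times> (B \<union> V) \<and> {NW T', NE T', SW T', SE T'} \<subseteq> B \<union> V)"

lemma map_shift_crossing_0: "map (shift_crossing 0) cs = cs"
proof (rule map_idI)
  show "shift_crossing 0 c = c" for c by (cases c) simp
qed

lemma plus_0_id: "(+) (0 :: nat) = id"
  by auto

lemma lessThan_add_4: "{..<n + 4} = {..<n} \<union> {n, Suc n, n + 2, n + 3 :: nat}"
  by auto

lemma lessThan_4_add: "{..<4 + n} = (+) 4 ` {..<n} \<union> {0, Suc 0, 2, 3 :: nat}"
  unfolding lessThan_atLeast0 image_add_atLeastLessThan by auto

text \<open>A crossing that comes second takes the numbers from \<open>npoints T\<close> on and
  leaves \<open>T\<close> unshifted; one that comes first takes 0 to 3 and shifts \<open>T\<close>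
  by 4.\<close>

lemma twisting_sum_right:
  "twisting 0 T (Crossing s (npoints T) (npoints T + 1) (npoints T + 2) (npoints T + 3))
     {(NE T, npoints T), (SE T, npoints T + 2)} (tangle_sum T (tangle_crossing s))"
  unfolding twisting_def Let_def
  by (simp add: tangle_sum_def shift_tangle_def tangle_crossing_def points_def plus_0_id lessThan_add_4
      map_shift_crossing_0 prod.map_id0)

lemma twisting_star_below:
  "twisting 0 T (Crossing s (npoints T) (npoints T + 1) (npoints T + 2) (npoints T + 3))
     {(SW T, npoints T), (SE T, npoints T + 1)} (tangle_star T (tangle_crossing s))"
  unfolding twisting_def Let_def
  by (simp add: tangle_star_def shift_tangle_def tangle_crossing_def points_def plus_0_id lessThan_add_4
      map_shift_crossing_0 prod.map_id0)

lemma twisting_sum_left: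
  "twisting 4 T (Crossing s 0 1 2 3) {(1, 4 + NW T), (3, 4 + SW T)} (tangle_sum (tangle_crossing s) T)"
  unfolding twisting_def Let_def
  by (simp add: tangle_sum_def shift_tangle_def tangle_crossing_def points_def lessThan_4_add) auto

lemma twisting_star_above:
  "twisting 4 T (Crossing s 0 1 2 3) {(2, 4 + NW T), (3, 4 + NE T)} (tangle_star (tangle_crossing s) T)"
  unfolding twisting_def Let_def
  by (simp add: tangle_star_def shift_tangle_def tangle_crossing_def points_def lessThan_4_add) auto

section \<open>Properties inherited by the tangle before a twist\<close>

locale twisted =
  fixes k :: nat and T :: tangle and c :: crossing and F :: "(nat \<times> nat) set" and T' :: tangle
  assumes twisting: "twisting k T c F T'" and wf: "wf_tangle T"
begin

definition V :: "nat set" where "V = {nw c, ne c, sw c, se c}"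

definition B :: "nat set" where "B = (+) k ` {NW T, NE T, SW T, SE T}"

lemma twistingD:
  "points T' = (+) k ` points T \<union> V" "V \<inter> (+) k ` points T = {}"
  "crossings T' \<in> {c # map (shift_crossing k) (crossings T), map (shift_crossing k) (crossings T) @ [c]}"
  "joins T' = map_prod ((+) k) ((+) k) ` joins T \<union> F"
  "F \<subseteq> (B \<union> V) \<times> (B \<union> V)" "{NW T', NE T', SW T', SE T'} \<subseteq> B \<union> V"
  using twisting unfolding twisting_def Let_def V_def[symmetric] B_def[symmetric] by blast+

lemma set_crossings: "set (crossings T') = insert c (shift_crossing k ` set (crossings T))"
  using twistingD(3) by auto

lemma shift_corners:
  "nw (shift_crossing k d) = k + nw d" "ne (shift_crossing k d) = k + ne d"
  "sw (shift_crossing k d) = k + sw d" "se (shift_crossing k d) = k + se d"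
  by (cases d; simp)+

lemma B_subset: "B \<subseteq> (+) k ` points T"
  unfolding B_def using wf unfolding wf_tangle_def by (intro image_mono) simp

lemma wf': "wf_tangle T'"
proof -
  have "map_prod ((+) k) ((+) k) ` joins T \<subseteq> (+) k ` points T \<times> (+) k ` points T"
    using wf unfolding wf_tangle_def by auto
  then have "joins T' \<subseteq> points T' \<times> points T'"
    unfolding twistingD(1,4) using twistingD(5) B_subset by blast
  moreover have "{nw d, ne d, sw d, se d} \<subseteq> points T'" if "d \<in> set (crossings T')" for d
    using that wf unfolding set_crossings twistingD(1) wf_tangle_def V_def
    by (auto simp: shift_corners)
  moreover have "{NW T', NE T', SW T', SE T'} \<subseteq> points T'"
    using twistingD(6) B_subset unfolding twistingD(1) by blast
  ultimately show ?thesis unfolding wf_tangle_def by blast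
qed

lemma ends_shift:
  "over_ends (shift_crossing k d) = map_prod ((+) k) ((+) k) (over_ends d)"
  "under_ends (shift_crossing k d) = map_prod ((+) k) ((+) k) (under_ends d)"
  by (cases d; simp add: over_ends_def under_ends_def)+

lemma over_points': "(+) k ` over_points T \<subseteq> over_points T'"
  "under_points T' \<supseteq> (+) k ` under_points T"
  unfolding over_points_def under_points_def set_crossings by (auto simp: ends_shift)

lemma glue_shift: "(x, y) \<in> glue T {} \<Longrightarrow> (k + x, k + y) \<in> glue T' {}"
proof -
  assume "(x, y) \<in> glue T {}"
  then have "(k + x, k + y) \<in> (map_prod ((+) k) ((+) k) ` sym_closure (joins T))\<^sup>*"
    unfolding glue_eq by (simp add: rtrancl_map_prod)
  moreover have "(map_prod ((+) k) ((+) k) ` sym_closure (joins T))\<^sup>* \<subseteq> (sym_closure (joins T'))\<^sup>*"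
    unfolding twistingD(4) sym_closure_Un sym_closure_map_prod by (rule rtrancl_mono) simp
  ultimately show ?thesis unfolding glue_eq sym_closure_empty Un_empty_right by (rule subsetD[rotated])
qed

lemma alternating_before:
  assumes "alternating T'"
  shows "alternating T"
  unfolding alternating_def
proof (intro conjI ballI impI)
  fix x y :: nat
  assume xy: "x \<noteq> y"
  then have "k + x \<noteq> k + y" by simp
  then show "(x, y) \<notin> glue T {}" if "x \<in> over_points T" "y \<in> over_points T"
    using assms that over_points'(1) glue_shift unfolding alternating_def by blast
  show "(x, y) \<notin> glue T {}" if "x \<in> under_points T" "y \<in> under_points T"
    using assms that \<open>k + x \<noteq> k + y\<close> over_points'(2) glue_shift unfolding alternating_def by blast
qed

text \<open>The edge of \<open>T\<close> from \<open>x\<close> to the corner \<open>y\<close> is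
  prolonged by the new join to \<open>v\<close>, and so becomes an edge of \<open>T'\<close> between
  different crossing corners.\<close>

lemma alternating_clash:
  assumes alt: "alternating T'" and "(y, x) \<in> glue T {}" "(k + y, v) \<in> sym_closure F" "v \<in> V"
  shows "\<not> (x \<in> over_points T \<and> v \<in> over_points T')" "\<not> (x \<in> under_points T \<and> v \<in> under_points T')"
proof -
  have "sym (sym_closure (joins T'))" by (rule sym_sym_closure)
  moreover have "(k + y, k + x) \<in> glue T' {}" using assms(2) by (rule glue_shift)
  ultimately have "(k + x, k + y) \<in> glue T' {}" unfolding glue_eq by (simp add: sym_rtrancl symD)
  moreover have "(k + y, v) \<in> sym_closure (joins T')" using assms(3) unfolding twistingD(4) sym_closure_Un by simp
  ultimately have "(k + x, v) \<in> glue T' {}" unfolding glue_eq by (simp add: rtrancl_into_rtrancl)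
  moreover have "x \<in> points T" if "x \<in> over_points T \<or> x \<in> under_points T"
    using that wf unfolding over_points_def under_points_def wf_tangle_def over_ends_def under_ends_def
    by (auto split: if_splits)
  then have "k + x \<noteq> v" if "x \<in> over_points T \<or> x \<in> under_points T"
    using that twistingD(2) assms(4) by auto
  ultimately show "\<not> (x \<in> over_points T \<and> v \<in> over_points T')" "\<not> (x \<in> under_points T \<and> v \<in> under_points T')"
    using alt over_points' unfolding alternating_def by blast+
qed

text \<open>A component split off inside the disc contains no corner of \<open>T\<close>, and new
  material is attached at the corners only. The same component, renumbered, therefore splits off in
  \<open>T'\<close>.\<close>

lemma reduced_before:
  assumes "reduced_tangle T'"
  shows "reduced_tangle T"
  unfolding reduced_tangle_def
proof (intro allI impI notI)
  fix i assume i: "i < length (crossings T)" and "nugatory_in_disc T i"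
  then obtain z X where X: "X \<in> components (smooth_at T i z)" "X \<inter> {NW T, NE T, SW T, SE T} = {}"
    unfolding nugatory_in_disc_def by blast
  let ?h = "(+) k" and ?hh = "map_prod ((+) k) ((+) k)"
  let ?star = "\<lambda>D. \<Union>c\<in>D. {(nw c, ne c), (nw c, sw c), (nw c, se c)}"
  let ?rest = "take i (crossings T) @ drop (Suc i) (crossings T)"
  define G where "G = sym_closure (joins T \<union> smoothing z (crossings T ! i)) \<union> sym_closure (?star (set ?rest))"
  have comps: "components (smooth_at T i z) = points T // G\<^sup>*"
    unfolding components_def glue_eq by (simp add: points_def smooth_at_def G_def Un_assoc)
  have rest: "set ?rest \<subseteq> set (crossings T)"
    using set_take_subset[of i "crossings T"] set_drop_subset[of "Suc i" "crossings T"] by auto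
  have corners: "{nw d, ne d, sw d, se d} \<subseteq> points T" if "d \<in> set (crossings T)" for d
    using that wf unfolding wf_tangle_def by blast
  have "crossings T ! i \<in> set (crossings T)" using i by simp
  then have "smoothing z (crossings T ! i) \<subseteq> points T \<times> points T"
    using corners[of "crossings T ! i"] by (simp add: smoothing_def)
  moreover have "?star (set ?rest) \<subseteq> points T \<times> points T" using rest corners by fastforce
  ultimately have GP: "G \<subseteq> points T \<times> points T"
    using wf unfolding G_def wf_tangle_def by (intro Un_least sym_closure_subset) auto
  have "sym G" unfolding G_def by (intro sym_Un sym_sym_closure)
  then have compX: "component G X" using X(1) unfolding comps by (rule quotient_component)
  obtain x where x: "x \<in> points T" "X = G\<^sup>* `` {x}" using X(1) unfolding comps by (auto elim: quotientE)
  have "G `` points T \<subseteq> points T" using GP by blast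
  then have XP: "X \<subseteq> points T" using x rtrancl_closed[of x _ G "points T"] by blast
  have xX: "x \<in> X" using x by simp
  \<comment> \<open>The index of the old crossing moves up by one exactly when the new crossing is
    put in front.\<close>
  obtain j where j: "j < length (crossings T')" "crossings T' ! j = shift_crossing k (crossings T ! i)"
    "set (take j (crossings T') @ drop (Suc j) (crossings T')) = insert c (shift_crossing k ` set ?rest)"
  proof (cases "crossings T' = c # map (shift_crossing k) (crossings T)")
    case True
    then show ?thesis
      using i by (intro that[of "Suc i"]) (auto simp: take_map drop_map)
  next
    case False
    then have "crossings T' = map (shift_crossing k) (crossings T) @ [c]" using twistingD(3) by auto
    then show ?thesis
      using i by (intro that[of i]) (auto simp: take_map drop_map nth_append)
  qed
  define G' where "G' = sym_closure (joins T' \<union> smoothing z (crossings T' ! j)) \<union>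
    sym_closure (?star (set (take j (crossings T') @ drop (Suc j) (crossings T'))))"
  have comps': "components (smooth_at T' j z) = points T' // G'\<^sup>*"
    unfolding components_def glue_eq by (simp add: points_def smooth_at_def G'_def Un_assoc)
  have smooth: "smoothing z (shift_crossing k d) = ?hh ` smoothing z d" for d
    by (cases d) (simp add: smoothing_def)
  have star: "?star (shift_crossing k ` D) = ?hh ` ?star D" for D
    by (auto simp: shift_corners image_iff)
  have star_insert: "?star (insert c (shift_crossing k ` D)) = ?star {c} \<union> ?hh ` ?star D" for D
    unfolding star[symmetric] by auto
  have G': "G' = ?hh ` G \<union> sym_closure (F \<union> ?star {c})"
    unfolding G'_def G_def j(2,3) twistingD(4) smooth star_insert
    by (simp only: sym_closure_Un sym_closure_map_prod image_Un Un_ac)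
  have "F \<union> ?star {c} \<subseteq> (B \<union> V) \<times> (B \<union> V)" using twistingD(5) unfolding V_def by auto
  then have extra: "sym_closure (F \<union> ?star {c}) \<subseteq> (B \<union> V) \<times> (B \<union> V)" by (rule sym_closure_subset)
  have disj: "?h ` X \<inter> (B \<union> V) = {}"
  proof -
    have "?h ` X \<inter> V = {}" using XP twistingD(2) by blast
    moreover have "?h ` X \<inter> B = {}" using X(2) unfolding B_def by auto
    ultimately show ?thesis by blast
  qed
  have comp: "component (?hh ` G) (?h ` X)" using compX by (rule component_map_prod) simp
  have "component G' (?h ` X)"
  proof (rule component_mono[OF comp])
    show "?hh ` G \<subseteq> G'" unfolding G' by simp
    have "(?hh ` G) `` (?h ` X) \<subseteq> ?h ` X" using comp unfolding component_def by simp
    then show "G' `` (?h ` X) \<subseteq> ?h ` X" unfolding G' using extra disj by blast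
  qed
  then have "?h ` X \<in> components (smooth_at T' j z)"
    unfolding comps' using xX x(1) twistingD(1) by (intro component_quotient[of _ _ "k + x"]) auto
  moreover have "?h ` X \<inter> {NW T', NE T', SW T', SE T'} = {}" using disj twistingD(6) by blast
  ultimately have "nugatory_in_disc T' j" unfolding nugatory_in_disc_def by blast
  then show False using assms j(1) unfolding reduced_tangle_def by blast
qed

end

text \<open>A set \<open>X\<close> closed under the smoothed graph suffices in place of a component:
  the class of \<open>x\<close> stays inside \<open>X\<close> and so misses the boundary.\<close>

lemma kink:
  assumes "i < length (crossings T)"
    "x \<in> X" "x \<in> points T" "(sym_closure (joins T \<union> smoothing z (crossings T ! i)) \<union>
      sym_closure (\<Union>c\<in>set (take i (crossings T) @ drop (Suc i) (crossings T)).
        {(nw c, ne c), (nw c, sw c), (nw c, se c)})) `` X \<subseteq> X"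
    "X \<inter> {NW T, NE T, SW T, SE T} = {}"
  shows "\<not> reduced_tangle T"
proof -
  let ?G = "sym_closure (joins T \<union> smoothing z (crossings T ! i)) \<union>
      sym_closure (\<Union>c\<in>set (take i (crossings T) @ drop (Suc i) (crossings T)).
        {(nw c, ne c), (nw c, sw c), (nw c, se c)})"
  have "components (smooth_at T i z) = points T // ?G\<^sup>*"
    unfolding components_def glue_eq by (simp add: points_def smooth_at_def Un_assoc)
  then have "?G\<^sup>* `` {x} \<in> components (smooth_at T i z)" using assms(3) by (simp add: quotientI)
  moreover have "?G\<^sup>* `` {x} \<subseteq> X" using rtrancl_closed[OF _ assms(2,4)] by blast
  ultimately show ?thesis
    using assms(1,5) unfolding reduced_tangle_def nugatory_in_disc_def by blast
qed

text \<open>Here the crossing is attached to both ends of a single arc. The smoothing that turns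
  back closes this arc into a circle, whose four points form the given set.\<close>

lemma kinks:
  "\<not> reduced_tangle (tangle_sum tangle_infinity (tangle_crossing s))"
  "\<not> reduced_tangle (tangle_sum (tangle_crossing s) tangle_infinity)"
  "\<not> reduced_tangle (tangle_star tangle_zero (tangle_crossing s))"
  "\<not> reduced_tangle (tangle_star (tangle_crossing s) tangle_zero)"
proof -
  note defs = tangle_sum_def tangle_star_def shift_tangle_def tangle_crossing_def tangle_zero_def
    tangle_infinity_def points_def Let_def sym_closure_def smoothing_def
  show "\<not> reduced_tangle (tangle_sum tangle_infinity (tangle_crossing s))"
    by (rule kink[of 0 _ 1 "{1, 3, 4, 6}" False]) (simp_all add: defs, auto)
  show "\<not> reduced_tangle (tangle_sum (tangle_crossing s) tangle_infinity)"
    by (rule kink[of 0 _ 1 "{1, 3, 4, 6}" False]) (simp_all add: defs, auto)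
  show "\<not> reduced_tangle (tangle_star tangle_zero (tangle_crossing s))"
    by (rule kink[of 0 _ 2 "{2, 3, 4, 5}" True]) (simp_all add: defs, auto)
  show "\<not> reduced_tangle (tangle_star (tangle_crossing s) tangle_zero)"
    by (rule kink[of 0 _ 2 "{2, 3, 4, 5}" True]) (simp_all add: defs, auto)
qed

section \<open>Reduced alternating rational tangles\<close>

text \<open>\<open>s\<close> is the common type of all crossings; it decides which diagonal
  \<open>p\<close>, \<open>q\<close> carries the extreme colors. For either type the pairing
  \<open>p-r\<close>, \<open>q-t\<close> is that of [0], which is also what the numerator closure
  joins; hence \<open>b\<close> gives the determinant.\<close>

definition twist_tangle :: "bool \<Rightarrow> tangle \<Rightarrow> int \<Rightarrow> int \<Rightarrow> bool" where
  "twist_tangle s T a b \<longleftrightarrow>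
     alternating_twist s (points T) (crossings T) (sym_closure (joins T))
       (if s then NE T else NW T) (if s then SW T else SE T)
       (if s then NW T else NE T) (if s then SE T else SW T) a b"

lemma twist_tangle_zero: "twist_tangle s tangle_zero 1 0"
  unfolding twist_tangle_def
  by (cases s) (simp_all add: tangle_zero_def points_def,
    (rule alternating_twist.base; force simp: sym_closure_insert)+)

text \<open>\<open>base\<close> yields only the weights 1 and 0. They are exchanged by
  \<open>switch\<close>, which also negates the flag, so \<open>base\<close> is taken with the
  opposite flag.\<close>

lemma twist_tangle_infinity: "twist_tangle s tangle_infinity 0 1"
proof -
  have P: "{..<4} = {0, 1, 2, 3 :: nat}" by auto
  have "alternating_twist False {..<4} [] (sym_closure {(0, 2), (1, 3)}) 1 2 3 0 1 0"
    by (rule alternating_twist.base) (auto simp: P sym_closure_insert)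
  moreover have "alternating_twist True {..<4} [] (sym_closure {(0, 2), (1, 3)}) 0 3 2 1 1 0"
    by (rule alternating_twist.base) (auto simp: P sym_closure_insert)
  ultimately show ?thesis
    unfolding twist_tangle_def
    by (cases s) (auto simp: tangle_infinity_def points_def dest: alternating_twist.switch)
qed

lemmas tangle_simps = tangle_sum_def tangle_star_def shift_tangle_def tangle_crossing_def points_def
  Let_def lessThan_add_4 lessThan_4_add map_shift_crossing_0 sym_closure_insert sym_closure_map_prod

lemma twist_tangle_simps:
  "twist_tangle True T a b \<longleftrightarrow> alternating_twist True (points T) (crossings T) (sym_closure (joins T))
     (NE T) (SW T) (NW T) (SE T) a b"
  "twist_tangle False T a b \<longleftrightarrow> alternating_twist False (points T) (crossings T) (sym_closure (joins T))
     (NW T) (SE T) (NE T) (SW T) a b"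
  by (simp_all add: twist_tangle_def)

lemma tangle_corners:
  "NW (tangle_sum T S) = NW T" "SW (tangle_sum T S) = SW T"
  "NE (tangle_sum T S) = npoints T + NE S" "SE (tangle_sum T S) = npoints T + SE S"
  "NW (tangle_star T S) = NW T" "NE (tangle_star T S) = NE T"
  "SW (tangle_star T S) = npoints T + SW S" "SE (tangle_star T S) = npoints T + SE S"
  "NW (tangle_crossing s) = 0" "NE (tangle_crossing s) = 1"
  "SW (tangle_crossing s) = 2" "SE (tangle_crossing s) = 3" "npoints (tangle_crossing s) = 4"
  by (simp_all add: tangle_sum_def tangle_star_def tangle_crossing_def shift_tangle_def Let_def)

text \<open>The right side of the disc is the side \<open>p t\<close> for crossings [+1] and the
  side \<open>q r\<close> for crossings [-1]; both change the weights alike. Above and below lie the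
  sides \<open>p r\<close> and \<open>q t\<close>, where the weights exchange roles.\<close>

lemma twist_tangle_sum_right:
  assumes "twist_tangle s T a b" "0 < a"
  shows "twist_tangle s (tangle_sum T (tangle_crossing s)) a (a + b)"
proof (cases s rule: bool.exhaust[case_names True False])
  case True
  note tw = assms(1)[unfolded True twist_tangle_simps]
  show ?thesis
    unfolding True twist_tangle_simps tangle_corners
    by (rule alternating_twist.attach[OF tw assms(2) twist_crossing_Crossing(1)[of "npoints T" "npoints T + 1" "npoints T + 2" "npoints T + 3"]])
      (auto simp: tangle_simps)
next
  case False
  note tw = assms(1)[unfolded False twist_tangle_simps]
  show ?thesis
    unfolding False twist_tangle_simps tangle_corners
    by (rule alternating_twist_attach_qr[OF tw assms(2) twist_crossing_Crossing(5)[of "npoints T" "npoints T + 1" "npoints T + 2" "npoints T + 3"]])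
      (auto simp: tangle_simps)
qed

lemma twist_tangle_sum_left:
  assumes "twist_tangle s T a b" "0 < a"
  shows "twist_tangle s (tangle_sum (tangle_crossing s) T) a (a + b)"
proof (cases s rule: bool.exhaust[case_names True False])
  case True
  note tw = assms(1)[unfolded True twist_tangle_simps]
  show ?thesis
    unfolding True twist_tangle_simps tangle_corners
    by (rule alternating_twist_attach_qr[OF alternating_twist_shift[OF tw, of 4] assms(2) twist_crossing_Crossing(2)[of 0 1 2 3]])
      (auto simp: tangle_simps)
next
  case False
  note tw = assms(1)[unfolded False twist_tangle_simps]
  show ?thesis
    unfolding False twist_tangle_simps tangle_corners
    by (rule alternating_twist.attach[OF alternating_twist_shift[OF tw, of 4] assms(2) twist_crossing_Crossing(6)[of 0 1 2 3]])
      (auto simp: tangle_simps)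
qed

lemma twist_tangle_star_below:
  assumes "twist_tangle s T a b" "0 < b"
  shows "twist_tangle s (tangle_star T (tangle_crossing s)) (b + a) b"
proof (cases s rule: bool.exhaust[case_names True False])
  case True
  note tw = assms(1)[unfolded True twist_tangle_simps]
  show ?thesis
    unfolding True twist_tangle_simps tangle_corners
    by (rule alternating_twist_attach_qt[OF tw assms(2) twist_crossing_Crossing(3)[of "npoints T" "npoints T + 1" "npoints T + 2" "npoints T + 3"]])
      (auto simp: tangle_simps)
next
  case False
  note tw = assms(1)[unfolded False twist_tangle_simps]
  show ?thesis
    unfolding False twist_tangle_simps tangle_corners
    by (rule alternating_twist_attach_qt[OF tw assms(2) twist_crossing_Crossing(7)[of "npoints T" "npoints T + 1" "npoints T + 2" "npoints T + 3"]])
      (auto simp: tangle_simps)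
qed

lemma twist_tangle_star_above:
  assumes "twist_tangle s T a b" "0 < b"
  shows "twist_tangle s (tangle_star (tangle_crossing s) T) (b + a) b"
proof (cases s rule: bool.exhaust[case_names True False])
  case True
  note tw = assms(1)[unfolded True twist_tangle_simps]
  show ?thesis
    unfolding True twist_tangle_simps tangle_corners
    by (rule alternating_twist_attach_pr[OF alternating_twist_shift[OF tw, of 4] assms(2) twist_crossing_Crossing(4)[of 0 1 2 3]])
      (auto simp: tangle_simps)
next
  case False
  note tw = assms(1)[unfolded False twist_tangle_simps]
  show ?thesis
    unfolding False twist_tangle_simps tangle_corners
    by (rule alternating_twist_attach_pr[OF alternating_twist_shift[OF tw, of 4] assms(2) twist_crossing_Crossing(8)[of 0 1 2 3]])
      (auto simp: tangle_simps)
qed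

context twisted
begin

text \<open>The joined ends \<open>y\<close> and \<open>v\<close> have the same height exactly when the two signs differ.\<close>

lemma flag_agrees:
  assumes "alternating T'" "twist_tangle s T a b" "crossings T \<noteq> []" "(k + y, v) \<in> sym_closure F"
    and ends: "y \<in> {NE T, SW T} \<and> v \<in> {nw c, se c} \<or> y \<in> {NW T, SE T} \<and> v \<in> {ne c, sw c}"
  shows "over_NW_SE c = s"
proof (rule ccontr)
  assume flag: "over_NW_SE c \<noteq> s"
  have vV: "v \<in> V" using ends by (auto simp: V_def)
  have c: "v \<in> over_points T'" if "v \<in> {fst (over_ends c), snd (over_ends c)}"
    using that unfolding over_points_def set_crossings by blast
  have c': "v \<in> under_points T'" if "v \<in> {fst (under_ends c), snd (under_ends c)}"
    using that unfolding under_points_def set_crossings by blast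
  note tw = assms(2)[unfolded twist_tangle_def]
  note ce = alternating_twist_corner_ends[OF tw assms(3)]
  have glue: "(sym_closure (joins T))\<^sup>* = glue T {}" by (simp add: glue_eq)
  consider "\<exists>x\<in>over_points T. (y, x) \<in> glue T {}" "v \<in> over_points T'"
    | "\<exists>x\<in>under_points T. (y, x) \<in> glue T {}" "v \<in> under_points T'"
    using ends ce flag c c' unfolding glue over_points_def under_points_def
    by (cases s) (auto simp: over_ends_def under_ends_def)
  then show False using alternating_clash[OF assms(1) _ assms(4) vV] by cases blast+
qed

end

lemma rational_no_crossings:
  "rational_twist_form T \<Longrightarrow> crossings T = [] \<Longrightarrow> T = tangle_zero \<or> T = tangle_infinity"
  by (induction rule: rational_twist_form.induct)
    (auto simp: tangle_sum_def tangle_star_def shift_tangle_def tangle_crossing_def Let_def)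

lemma twist_tangle_empty:
  assumes "rational_twist_form T" "crossings T = []"
  shows "T = tangle_zero \<and> twist_tangle s T 1 0 \<or> T = tangle_infinity \<and> twist_tangle s T 0 1"
  using rational_no_crossings[OF assms] twist_tangle_zero twist_tangle_infinity by auto

text \<open>Alternation and reducedness stand inside as premises because they pass from a twisted
  tangle down to the smaller one, while the induction goes upwards.\<close>

definition reduced_twist :: "tangle \<Rightarrow> bool" where
  "reduced_twist T \<longleftrightarrow> rational_twist_form T \<and> wf_tangle T \<and>
     (alternating T \<longrightarrow> reduced_tangle T \<longrightarrow> (\<exists>s a b. twist_tangle s T a b))"

text \<open>The conclusion concerns \<open>T\<close> before the twist, already with the type
  \<open>s\<close> of the new crossing: this form gives the induction step and, at the end, the
  color range of the tangle inside the closure.\<close>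

lemma reduced_twist_sum:
  assumes T: "reduced_twist T" and T': "alternating T'" "reduced_tangle T'"
    and sum: "T' = tangle_sum T (tangle_crossing s) \<or> T' = tangle_sum (tangle_crossing s) T"
  shows "\<exists>a b. 0 < a \<and> twist_tangle s T a b"
proof -
  have T0: "rational_twist_form T" "wf_tangle T" using T unfolding reduced_twist_def by auto
  obtain k c F y v where tw: "twisted k T c F T'" and c: "over_NW_SE c = s"
    and F: "(k + y, v) \<in> sym_closure F"
    and ends: "y \<in> {NE T, SW T} \<and> v \<in> {nw c, se c} \<or> y \<in> {NW T, SE T} \<and> v \<in> {ne c, sw c}"
    using sum
  proof
    assume T': "T' = tangle_sum T (tangle_crossing s)"
    show thesis
      by (rule that[OF twisted.intro[OF twisting_sum_right[of T s, folded T'] T0(2)],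
            of "NE T" "npoints T"]) (simp_all add: sym_closure_insert)
  next
    assume T': "T' = tangle_sum (tangle_crossing s) T"
    show thesis
      by (rule that[OF twisted.intro[OF twisting_sum_left[of T s, folded T'] T0(2)],
            of "NW T" 1]) (simp_all add: sym_closure_insert)
  qed
  show ?thesis
  \<comment> \<open>Without crossings any \<open>s\<close> is admissible, and the kinks rule out
    [\<infinity>], for which \<open>a = 0\<close>. Otherwise the type is forced by
    alternation.\<close>
  proof (cases "crossings T = []")
    case True
    then have "T = tangle_zero \<and> twist_tangle s T 1 0"
      using twist_tangle_empty[OF T0(1), of s] T'(2) sum kinks(1,2) by metis
    then show ?thesis by (metis zero_less_one)
  next
    case False
    obtain s' a b where tT: "twist_tangle s' T a b"
      using T twisted.alternating_before[OF tw T'(1)] twisted.reduced_before[OF tw T'(2)]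
      unfolding reduced_twist_def by blast
    have "s = s'" using twisted.flag_agrees[OF tw T'(1) tT False F ends] c by simp
    moreover have "0 < a" using alternating_twist_wf[OF tT[unfolded twist_tangle_def]] False by simp
    ultimately show ?thesis using tT by blast
  qed
qed

lemma reduced_twist_star:
  assumes T: "reduced_twist T" and T': "alternating T'" "reduced_tangle T'"
    and star: "T' = tangle_star T (tangle_crossing s) \<or> T' = tangle_star (tangle_crossing s) T"
  shows "\<exists>a b. 0 < b \<and> twist_tangle s T a b"
proof -
  have T0: "rational_twist_form T" "wf_tangle T" using T unfolding reduced_twist_def by auto
  obtain k c F y v where tw: "twisted k T c F T'" and c: "over_NW_SE c = s"
    and F: "(k + y, v) \<in> sym_closure F"
    and ends: "y \<in> {NE T, SW T} \<and> v \<in> {nw c, se c} \<or> y \<in> {NW T, SE T} \<and> v \<in> {ne c, sw c}"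
    using star
  proof
    assume T': "T' = tangle_star T (tangle_crossing s)"
    show thesis
      by (rule that[OF twisted.intro[OF twisting_star_below[of T s, folded T'] T0(2)],
            of "SW T" "npoints T"]) (simp_all add: sym_closure_insert)
  next
    assume T': "T' = tangle_star (tangle_crossing s) T"
    show thesis
      by (rule that[OF twisted.intro[OF twisting_star_above[of T s, folded T'] T0(2)],
            of "NW T" 2]) (simp_all add: sym_closure_insert)
  qed
  show ?thesis
  proof (cases "crossings T = []")
    case True
    then have "T = tangle_infinity \<and> twist_tangle s T 0 1"
      using twist_tangle_empty[OF T0(1), of s] T'(2) star kinks(3,4) by metis
    then show ?thesis by (metis zero_less_one)
  next
    case False
    obtain s' a b where tT: "twist_tangle s' T a b"
      using T twisted.alternating_before[OF tw T'(1)] twisted.reduced_before[OF tw T'(2)]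
      unfolding reduced_twist_def by blast
    have "s = s'" using twisted.flag_agrees[OF tw T'(1) tT False F ends] c by simp
    moreover have "0 < b" using alternating_twist_wf[OF tT[unfolded twist_tangle_def]] False by simp
    ultimately show ?thesis using tT by blast
  qed
qed

lemma rational_reduced_twist: "rational_twist_form T \<Longrightarrow> reduced_twist T"
proof (induction rule: rational_twist_form.induct)
  case zero
  have "wf_tangle tangle_zero" by (simp add: wf_tangle_def tangle_zero_def points_def)
  then show ?case unfolding reduced_twist_def
    using rational_twist_form.zero twist_tangle_zero by blast
next
  case infinity
  have "wf_tangle tangle_infinity" by (simp add: wf_tangle_def tangle_infinity_def points_def)
  then show ?case unfolding reduced_twist_def
    using rational_twist_form.infinity twist_tangle_infinity by blast
next
  case (sum_right T E)
  then obtain s where E: "E = tangle_crossing s" by blast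
  have "wf_tangle T" using sum_right.IH unfolding reduced_twist_def by simp
  then have "wf_tangle (tangle_sum T E)"
    unfolding E by (rule twisted.wf'[OF twisted.intro[OF twisting_sum_right]])
  then show ?case
    using reduced_twist_sum[OF sum_right.IH] twist_tangle_sum_right
      rational_twist_form.sum_right[OF sum_right.hyps] unfolding reduced_twist_def E by metis
next
  case (sum_left T E)
  then obtain s where E: "E = tangle_crossing s" by blast
  have "wf_tangle T" using sum_left.IH unfolding reduced_twist_def by simp
  then have "wf_tangle (tangle_sum E T)"
    unfolding E by (rule twisted.wf'[OF twisted.intro[OF twisting_sum_left]])
  then show ?case
    using reduced_twist_sum[OF sum_left.IH] twist_tangle_sum_left
      rational_twist_form.sum_left[OF sum_left.hyps] unfolding reduced_twist_def E by metis
next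
  case (star_below T E)
  then obtain s where E: "E = tangle_crossing s" by blast
  have "wf_tangle T" using star_below.IH unfolding reduced_twist_def by simp
  then have "wf_tangle (tangle_star T E)"
    unfolding E by (rule twisted.wf'[OF twisted.intro[OF twisting_star_below]])
  then show ?case
    using reduced_twist_star[OF star_below.IH] twist_tangle_star_below
      rational_twist_form.star_below[OF star_below.hyps] unfolding reduced_twist_def E by metis
next
  case (star_above T E)
  then obtain s where E: "E = tangle_crossing s" by blast
  have "wf_tangle T" using star_above.IH unfolding reduced_twist_def by simp
  then have "wf_tangle (tangle_star E T)"
    unfolding E by (rule twisted.wf'[OF twisted.intro[OF twisting_star_above]])
  then show ?case
    using reduced_twist_star[OF star_above.IH] twist_tangle_star_above
      rational_twist_form.star_above[OF star_above.hyps] unfolding reduced_twist_def E by metis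
qed

section \<open>Distinct colors\<close>

lemma arc_rel_eq: "arc_rel D = (arc_graph (crossings D) (sym_closure (joins D)))\<^sup>*"
  by (simp add: arc_rel_def glue_eq)

lemma arcs_eq: "arcs D = arc_of D ` points D"
  by (auto simp: arcs_def arc_of_def quotient_def)

lemma arc_of_cong: "(x, y) \<in> arc_rel D \<Longrightarrow> arc_of D x = arc_of D y"
proof -
  have "equiv UNIV (arc_rel D)"
    unfolding arc_rel_eq by (intro equiv_rtrancl sym_Un sym_sym_closure)
  then show "(x, y) \<in> arc_rel D \<Longrightarrow> arc_of D x = arc_of D y"
    unfolding arc_of_def by (rule equiv_class_eq)
qed

lemma inj_on_arcs:
  assumes "\<And>x y. x \<in> points D \<Longrightarrow> y \<in> points D \<Longrightarrow> C (arc_of D x) = C (arc_of D y) \<Longrightarrow> (x, y) \<in> arc_rel D"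
  shows "inj_on C (arcs D)"
  unfolding arcs_eq inj_on_def using assms arc_of_cong by blast

lemma coloring_mod_coloring:
  assumes "coloring R D C" and "\<And>x y z. x \<oplus>\<^bsub>R\<^esub> y = z \<oplus>\<^bsub>R\<^esub> z \<Longrightarrow> [x + y = 2 * z] (mod n)"
  shows "mod_coloring n (crossings D) (sym_closure (joins D)) (\<lambda>x. C (arc_of D x))"
proof -
  let ?f = "\<lambda>x. C (arc_of D x)"
  have graph: "?f x = ?f y" if "(x, y) \<in> arc_graph (crossings D) (sym_closure (joins D))" for x y
    using arc_of_cong[of x y D] r_into_rtrancl[OF that] unfolding arc_rel_eq by metis
  show ?thesis
    unfolding mod_coloring_def
  proof (intro conjI ballI, safe)
    show "[?f x = ?f y] (mod n)" if "(x, y) \<in> sym_closure (joins D)" for x y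
      using graph[of x y] that by simp
  next
    fix c assume c: "c \<in> set (crossings D)"
    then have "(fst (over_ends c), snd (over_ends c)) \<in> sym_closure (over_ends ` set (crossings D))"
      by (auto simp: sym_closure_def)
    then have "?f (fst (over_ends c)) = ?f (snd (over_ends c))" by (intro graph UnI2)
    then show "[?f (fst (over_ends c)) = ?f (snd (over_ends c))] (mod n)" by simp
    show "[?f (fst (under_ends c)) + ?f (snd (under_ends c)) = 2 * ?f (fst (over_ends c))] (mod n)"
      using assms c unfolding coloring_def by blast
  qed
qed

lemma distinct_integer_colors:
  assumes "twist_tangle s T a b" "nontrivial_coloring \<Z> T C"
  shows "inj_on C (arcs T)"
proof -
  let ?f = "\<lambda>x. C (arc_of T x)"
  obtain g :: "nat \<Rightarrow> int" where
    g: "\<And>x y. x \<in> points T \<Longrightarrow> y \<in> points T \<Longrightarrow> g x = g y \<Longrightarrow> (x, y) \<in> arc_rel T"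
    "\<And>n f. mod_coloring n (crossings T) (sym_closure (joins T)) f \<Longrightarrow>
      (\<exists>\<alpha> m. \<forall>x\<in>points T. [f x = \<alpha> + m * g x] (mod n))"
    using alternating_twist_coloring[OF assms(1)[unfolded twist_tangle_def]] unfolding arc_rel_eq by blast
  \<comment> \<open>Congruence modulo 0 is equality of integers.\<close>
  have "mod_coloring 0 (crossings T) (sym_closure (joins T)) ?f"
    using assms(2) unfolding nontrivial_coloring_def
    by (intro coloring_mod_coloring[of \<Z>]) auto
  from g(2)[OF this] obtain \<alpha> m where "\<forall>x\<in>points T. [?f x = \<alpha> + m * g x] (mod 0)" by blast
  then have f: "?f x = \<alpha> + m * g x" if "x \<in> points T" for x using that by (simp add: cong_def)
  have "m \<noteq> 0"
  proof
    assume "m = 0"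
    then have "C A = \<alpha>" if "A \<in> arcs T" for A using that f unfolding arcs_eq by auto
    then show False using assms(2) unfolding nontrivial_coloring_def by metis
  qed
  show ?thesis
  proof (rule inj_on_arcs)
    fix x y assume "x \<in> points T" "y \<in> points T" "?f x = ?f y"
    then show "(x, y) \<in> arc_rel T" using f g(1) \<open>m \<noteq> 0\<close> by simp
  qed
qed

text \<open>The joins of \<open>K\<close> identify the two extreme colors \<open>0\<close> and \<open>a + b = n\<close> of the tangle before
  its last crossing, and lead the new arc back to the corner \<open>r\<close>.\<close>

lemma distinct_residue_colors:
  assumes tw: "alternating_twist w P cs E p q r t a b" "twist_crossing c w o1 o2 u1 u2"
    and K: "points K = P \<union> {o1, o2, u1, u2}" "crossings K \<in> {c # cs, cs @ [c]}"
      "sym_closure (joins K) = E \<union> sym_closure {(p, o1), (t, u1), (u2, r), (q, o2)}"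
    and n: "prime (a + b)" and C: "nontrivial_coloring (residue_ring (a + b)) K C"
  shows "inj_on C (arcs K) \<and> card (C ` arcs K) = length (crossings K)"
proof -
  let ?n = "a + b" and ?f = "\<lambda>x. C (arc_of K x)"
  have n1: "1 < ?n" using n prime_gt_1_int by blast
  note wf = alternating_twist_wf[OF tw(1)]
  have corners: "finite P" "p \<in> P" "q \<in> P" "r \<in> P" "t \<in> P" using wf by auto
  have set_K: "set (crossings K) = insert c (set cs)" and len: "length (crossings K) = Suc (length cs)"
    using K(2) by auto
  obtain g :: "nat \<Rightarrow> int" where g: "g q = 0" "g p = ?n" "g ` P \<subseteq> {0..?n}" "card (g ` P) = length cs + 2"
    "\<And>x y. x \<in> P \<Longrightarrow> y \<in> P \<Longrightarrow> g x = g y \<Longrightarrow> (x, y) \<in> (arc_graph cs E)\<^sup>*"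
    "\<And>n f. mod_coloring n cs E f \<Longrightarrow> (\<exists>\<alpha> m. \<forall>x\<in>P. [f x = \<alpha> + m * g x] (mod n))"
    using alternating_twist_coloring[OF tw(1)] by blast
  have mono: "(arc_graph cs E)\<^sup>* \<subseteq> arc_rel K"
    unfolding arc_rel_eq K(3) set_K
    by (intro rtrancl_mono Un_mono Un_upper1 sym_closure_mono image_mono subset_insertI)
  have "sym (arc_rel K)" unfolding arc_rel_eq by (intro sym_rtrancl sym_Un sym_sym_closure)
  then have sym_K: "(y, x) \<in> arc_rel K" if "(x, y) \<in> arc_rel K" for x y using that by (meson symD)
  have trans_K: "(x, z) \<in> arc_rel K" if "(x, y) \<in> arc_rel K" "(y, z) \<in> arc_rel K" for x y z
    using that unfolding arc_rel_eq by (rule rtrancl_trans)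
  have edge: "(x, y) \<in> arc_rel K" if "(x, y) \<in> arc_graph (crossings K) (sym_closure (joins K))" for x y
    using that unfolding arc_rel_eq by (rule r_into_rtrancl)
  have new: "(o1, p) \<in> arc_rel K" "(u1, t) \<in> arc_rel K" "(u2, r) \<in> arc_rel K" "(q, o2) \<in> arc_rel K"
    by (rule edge, simp add: K(3) sym_closure_insert)+
  have "over_ends c \<in> {(o1, o2), (o2, o1)}" using tw(2) by (simp add: twist_crossing_def)
  then have o2: "(o2, o1) \<in> arc_rel K"
    by (intro edge) (auto simp: set_K sym_closure_def)
  \<comment> \<open>The overcrossing strand of the closed twist leads from \<open>q\<close> through
    \<open>o2\<close> and \<open>o1\<close> to \<open>p\<close>: colors 0 and \<open>a + b\<close>
    belong to one arc.\<close>
  have qp: "(q, p) \<in> arc_rel K" using trans_K[OF new(4) trans_K[OF o2 new(1)]] .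
  \<comment> \<open>In \<open>K\<close> the new end \<open>u2\<close> is joined to \<open>r\<close>,
    so every arc meets the old tangle and its coloring \<open>g\<close> is enough.\<close>
  have repr: "\<exists>z\<in>P. (x, z) \<in> arc_rel K" if "x \<in> points K" for x
  proof -
    have "x \<in> P \<or> x = o1 \<or> x = o2 \<or> x = u1 \<or> x = u2" using that K(1) by blast
    moreover have "(x, x) \<in> arc_rel K" by (simp add: arc_rel_eq)
    ultimately show ?thesis using corners new trans_K[OF o2 new(1)] by blast
  qed
  have col: "coloring (residue_ring ?n) K C" using C unfolding nontrivial_coloring_def by simp
  have "mod_coloring ?n (crossings K) (sym_closure (joins K)) ?f"
    using col by (rule coloring_mod_coloring) (simp add: residue_ring_def cong_def)
  then have "mod_coloring ?n cs E ?f" unfolding mod_coloring_def set_K K(3) by auto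
  from g(6)[OF this] obtain \<alpha> m where f: "\<And>x. x \<in> P \<Longrightarrow> [?f x = \<alpha> + m * g x] (mod ?n)" by blast
  have range: "?f x \<in> {0..?n - 1}" if "x \<in> points K" for x
  proof -
    have "arc_of K x \<in> arcs K" using that by (simp add: arcs_eq)
    then show ?thesis using col unfolding coloring_def residue_ring_def by auto
  qed
  have PK: "P \<subseteq> points K" using K(1) by blast
  have f_eq: "?f x = (\<alpha> + m * g x) mod ?n" if "x \<in> P" for x
    using f[OF that] range[of x] that PK by (auto simp: cong_def)
  have image: "C ` arcs K = ?f ` P"
  proof
    show "?f ` P \<subseteq> C ` arcs K" using PK by (auto simp: arcs_eq)
    show "C ` arcs K \<subseteq> ?f ` P"
    proof
      fix v assume "v \<in> C ` arcs K"
      then obtain x where x: "x \<in> points K" "v = ?f x" unfolding arcs_eq by blast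
      obtain z where z: "z \<in> P" "(x, z) \<in> arc_rel K" using repr[OF x(1)] by blast
      have "v = ?f z" using x(2) arc_of_cong[OF z(2)] by simp
      then show "v \<in> ?f ` P" using z(1) by (rule image_eqI)
    qed
  qed
  have "\<not> ?n dvd m"
  proof
    assume "?n dvd m"
    then have "?f x = \<alpha> mod ?n" if "x \<in> P" for x using f_eq[OF that] by (auto elim!: dvdE simp: mult.assoc)
    then have "v = \<alpha> mod ?n" if "v \<in> C ` arcs K" for v using that unfolding image by auto
    then show False using C unfolding nontrivial_coloring_def by (metis imageI)
  qed
  \<comment> \<open>Primality is used here: the slope \<open>m\<close> of a nontrivial coloring is
    invertible modulo \<open>a + b\<close>.\<close>
  then have dvd: "?n dvd m * v \<Longrightarrow> ?n dvd v" for v using n prime_dvd_multD by blast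
  have mod_inj: "?n dvd u - v" if "(\<alpha> + m * u) mod ?n = (\<alpha> + m * v) mod ?n" for u v
  proof (rule dvd)
    show "?n dvd m * (u - v)" using that by (simp add: mod_eq_dvd_iff right_diff_distrib)
  qed
  have inj: "(x, y) \<in> arc_rel K" if "x \<in> P" "y \<in> P" "?f x = ?f y" for x y
  proof -
    have dvd_diff: "?n dvd g x - g y" using mod_inj that f_eq by auto
    have "g x \<in> {0..?n}" "g y \<in> {0..?n}"
      using subsetD[OF g(3) imageI] that(1,2) by blast+
    then have bounds: "0 \<le> g x" "g x \<le> ?n" "0 \<le> g y" "g y \<le> ?n" by simp_all
    \<comment> \<open>Two numbers in the range from 0 to \<open>a + b\<close> that are congruent
      modulo \<open>a + b\<close> are equal or are its two ends.\<close>
    have "g x = g y \<or> g x = 0 \<and> g y = ?n \<or> g x = ?n \<and> g y = 0"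
    proof (rule ccontr)
      assume "\<not> ?thesis"
      then have ne: "g x - g y \<noteq> 0" and "\<bar>g x - g y\<bar> < \<bar>?n\<bar>" using bounds n1 by auto
      then show False using dvd_imp_le_int[OF ne dvd_diff] by linarith
    qed
    then consider "g x = g y" | "g x = g q" "g y = g p" | "g x = g p" "g y = g q" using g(1,2) by auto
    then show ?thesis
    proof cases
      case 1
      then show ?thesis using g(5) that mono by blast
    next
      case 2
      then have "(x, q) \<in> arc_rel K" "(p, y) \<in> arc_rel K" using g(5) that corners mono by force+
      then show ?thesis using trans_K qp by blast
    next
      case 3
      then have "(x, p) \<in> arc_rel K" "(q, y) \<in> arc_rel K" using g(5) that corners mono by force+
      then show ?thesis using trans_K sym_K[OF qp] by blast
    qed
  qed
  have "inj_on C (arcs K)"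
  proof (rule inj_on_arcs)
    fix x y assume xy: "x \<in> points K" "y \<in> points K" "?f x = ?f y"
    obtain x' y' where *: "x' \<in> P" "(x, x') \<in> arc_rel K" "y' \<in> P" "(y, y') \<in> arc_rel K"
      using repr xy by meson
    then have "?f x' = ?f y'" using xy(3) arc_of_cong by metis
    then have "(x', y') \<in> arc_rel K" using inj * by blast
    then show "(x, y) \<in> arc_rel K" using * sym_K trans_K by meson
  qed
  moreover have "card (C ` arcs K) = length (crossings K)"
  proof -
    let ?h = "\<lambda>v. (\<alpha> + m * v) mod ?n"
    have nP: "?n \<in> g ` P" using g(2) corners(2) by (metis imageI)
    have "?f ` P = ?h ` g ` P" using f_eq by (auto simp: image_image)
    \<comment> \<open>Of the \<open>length cs + 2\<close> integer colors the largest is dropped,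
      since it has the residue color of 0; the remaining \<open>length cs + 1\<close> are as many as
      the crossings of \<open>K\<close>.\<close>
    also have "\<dots> = ?h ` (g ` P - {?n})"
    proof -
      have "?h ?n = ?h 0" by simp
      moreover have "0 \<in> g ` P - {?n}" using g(1) corners n1 by (auto intro!: image_eqI[of _ _ q])
      ultimately have "?h ?n \<in> ?h ` (g ` P - {?n})" by (metis imageI)
      then have "insert (?h ?n) (?h ` (g ` P - {?n})) = ?h ` (g ` P - {?n})" by (rule insert_absorb)
      with image_insert[of ?h ?n "g ` P - {?n}", unfolded insert_Diff[OF nP]] show ?thesis
        by (rule trans)
    qed
    finally have "card (C ` arcs K) = card (?h ` (g ` P - {?n}))" unfolding image by simp
    also have "\<dots> = card (g ` P - {?n})"
    proof (rule card_image, rule inj_onI)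
      fix u v assume uv: "u \<in> g ` P - {?n}" "v \<in> g ` P - {?n}" "?h u = ?h v"
      have dvd_diff: "?n dvd u - v" using mod_inj[OF uv(3)] .
      have "0 \<le> u" "u < ?n" "0 \<le> v" "v < ?n" using uv(1,2) g(3) by force+
      then have "\<bar>u - v\<bar> < \<bar>?n\<bar>" by auto
      then show "u = v" using dvd_imp_le_int[OF _ dvd_diff] by (metis eq_iff_diff_eq_0 not_le)
    qed
    also have "\<dots> = length (crossings K)" using nP g(4) corners(1) len by simp
    finally show ?thesis .
  qed
  ultimately show ?thesis ..
qed

section \<open>Numerator closures that are not reduced\<close>

lemma disconnecting_smoothing:
  assumes "i < length (crossings K)" "x \<in> X" "x \<in> points K" "y \<in> points K" "y \<notin> X"
    "joins K \<union> smoothing z (crossings K ! i) \<union>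
      (\<Union>c\<in>set (take i (crossings K) @ drop (Suc i) (crossings K)).
        {(nw c, ne c), (nw c, sw c), (nw c, se c)}) \<subseteq> (- X) \<times> (- X) \<union> X \<times> X"
  shows "\<not> reduced_link K"
proof -
  let ?G = "sym_closure (joins K \<union> smoothing z (crossings K ! i)) \<union>
      sym_closure (\<Union>c\<in>set (take i (crossings K) @ drop (Suc i) (crossings K)).
        {(nw c, ne c), (nw c, sw c), (nw c, se c)})"
  have "sym_closure ((- X) \<times> (- X) \<union> X \<times> X) `` X \<subseteq> X" by (auto simp: sym_closure_def)
  then have closed: "?G `` X \<subseteq> X"
    unfolding sym_closure_Un[symmetric] using sym_closure_mono[OF assms(6)] by blast
  have comps: "components (smooth_at K i z) = points K // ?G\<^sup>*"
    unfolding components_def glue_eq by (simp add: points_def smooth_at_def Un_assoc)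
  have "\<not> connected_diagram (smooth_at K i z)"
  proof
    assume "connected_diagram (smooth_at K i z)"
    then obtain Z where Z: "points K // ?G\<^sup>* = {Z}"
      unfolding connected_diagram_def comps by (rule card_1_singletonE)
    have x: "?G\<^sup>* `` {x} = Z"
      using quotientI[OF assms(3), of "?G\<^sup>*"] unfolding Z by (rule singletonD)
    have y: "?G\<^sup>* `` {y} = Z"
      using quotientI[OF assms(4), of "?G\<^sup>*"] unfolding Z by (rule singletonD)
    have "y \<in> ?G\<^sup>* `` {y}" by (simp only: Image_singleton_iff rtrancl.rtrancl_refl)
    then have "(x, y) \<in> ?G\<^sup>*" unfolding y x[symmetric] by (simp only: Image_singleton_iff)
    then show False using rtrancl_closed[OF _ assms(2) closed] assms(5) by blast
  qed
  then show ?thesis using assms(1) unfolding reduced_link_def nugatory_def by blast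
qed

text \<open>The closing arc joins the two outer corners of a last vertical crossing. Its
  [0]-smoothing joins them once more and so cuts off a circle consisting of just these two
  points.\<close>

lemma numerator_star_not_reduced:
  assumes wf: "wf_tangle T"
  shows "\<not> reduced_link (numerator (tangle_star T (tangle_crossing s)))"
    "\<not> reduced_link (numerator (tangle_star (tangle_crossing s) T))"
proof -
  have T: "joins T \<subseteq> points T \<times> points T" "NW T \<in> points T" "NE T \<in> points T" "SW T \<in> points T" "SE T \<in> points T"
    "\<And>c. c \<in> set (crossings T) \<Longrightarrow> {nw c, ne c, sw c, se c} \<subseteq> points T"
    using wf unfolding wf_tangle_def by auto
  let ?n = "npoints T" and ?star = "\<lambda>cs. \<Union>c\<in>set cs. {(nw c, ne c), (nw c, sw c), (nw c, se c)}"
  have star: "?star (crossings T) \<subseteq> {..<?n} \<times> {..<?n}" using T(6) unfolding points_def by fastforce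
  have J: "joins T \<subseteq> {..<?n} \<times> {..<?n}" using T(1) by (simp add: points_def)
  have C: "NW T < ?n" "NE T < ?n" "SW T < ?n" "SE T < ?n" using T(2-5) by (simp_all add: points_def)
  let ?K = "numerator (tangle_star T (tangle_crossing s))"
  have K: "points ?K = {..<?n + 4}"
    "crossings ?K = crossings T @ [Crossing s ?n (?n + 1) (?n + 2) (?n + 3)]"
    "joins ?K = joins T \<union> {(SW T, ?n), (SE T, ?n + 1), (NW T, NE T), (?n + 2, ?n + 3)}"
    by (auto simp: numerator_def tangle_star_def tangle_crossing_def shift_tangle_def points_def Let_def)
  show "\<not> reduced_link ?K"
  proof (rule disconnecting_smoothing[of "length (crossings T)" _ "?n + 2" "{?n + 2, ?n + 3}" ?n True])
    have "{..<?n} \<subseteq> - {?n + 2, ?n + 3}" by auto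
    then have old: "{..<?n} \<times> {..<?n} \<subseteq> (- {?n + 2, ?n + 3}) \<times> (- {?n + 2, ?n + 3})" by blast
    show "joins ?K \<union> smoothing True (crossings ?K ! length (crossings T)) \<union>
        ?star (take (length (crossings T)) (crossings ?K) @ drop (Suc (length (crossings T))) (crossings ?K))
        \<subseteq> (- {?n + 2, ?n + 3}) \<times> (- {?n + 2, ?n + 3}) \<union> {?n + 2, ?n + 3} \<times> {?n + 2, ?n + 3}"
    proof (intro Un_least)
      show "joins ?K \<subseteq> (- {?n + 2, ?n + 3}) \<times> (- {?n + 2, ?n + 3}) \<union> {?n + 2, ?n + 3} \<times> {?n + 2, ?n + 3}"
        unfolding K(3) using J old C by (intro Un_least) (blast, simp)
      show "?star (take (length (crossings T)) (crossings ?K) @ drop (Suc (length (crossings T))) (crossings ?K))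
          \<subseteq> (- {?n + 2, ?n + 3}) \<times> (- {?n + 2, ?n + 3}) \<union> {?n + 2, ?n + 3} \<times> {?n + 2, ?n + 3}"
        unfolding K(2) using star old by simp blast
    qed (simp add: K(2) smoothing_def)
  qed (simp_all add: K)
  let ?L = "numerator (tangle_star (tangle_crossing s) T)" and ?hh = "map_prod ((+) 4) ((+) 4)"
  have L: "points ?L = {..<4 + ?n}"
    "crossings ?L = Crossing s 0 1 2 3 # map (shift_crossing 4) (crossings T)"
    "joins ?L = ?hh ` joins T \<union> {(2, 4 + NW T), (3, 4 + NE T), (0, 1), (4 + SW T, 4 + SE T)}"
    by (auto simp: numerator_def tangle_star_def tangle_crossing_def shift_tangle_def points_def Let_def)
  have corners: "nw (shift_crossing 4 d) = 4 + nw d" "ne (shift_crossing 4 d) = 4 + ne d"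
    "sw (shift_crossing 4 d) = 4 + sw d" "se (shift_crossing 4 d) = 4 + se d" for d
    by (cases d; simp)+
  show "\<not> reduced_link ?L"
  proof (rule disconnecting_smoothing[of 0 _ 0 "{0, 1}" 2 True])
    let ?D = "(- {0, 1}) \<times> (- {0, 1}) \<union> {0, 1} \<times> {0, 1 :: nat}"
    have "?hh ` joins T \<subseteq> ?D" by auto
    then have J': "joins ?L \<subseteq> ?D" unfolding L(3) by (intro Un_least) simp_all
    have star': "?star (map (shift_crossing 4) (crossings T)) \<subseteq> ?D"
      by (rule UN_least) (auto simp: corners)
    show "joins ?L \<union> smoothing True (crossings ?L ! 0) \<union>
        ?star (take 0 (crossings ?L) @ drop (Suc 0) (crossings ?L)) \<subseteq> ?D"
    proof (intro Un_least)
      show "smoothing True (crossings ?L ! 0) \<subseteq> ?D" by (simp add: L(2) smoothing_def)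
      have "take 0 (crossings ?L) @ drop (Suc 0) (crossings ?L) = map (shift_crossing 4) (crossings T)"
        by (simp add: L(2))
      then show "?star (take 0 (crossings ?L) @ drop (Suc 0) (crossings ?L)) \<subseteq> ?D"
        using star' by (simp only:)
    qed (fact J')
  qed (simp_all add: L)
qed

theorem theorem5:
  fixes T :: tangle
  assumes "rational_twist_form T"
    and "alternating T"
    and "reduced_tangle T"
  shows "(\<forall>C. nontrivial_coloring \<Z> T C \<longrightarrow> inj_on C (arcs T)) \<and>
    (\<forall>(K :: diagram) (p :: nat).
       K = numerator T \<and> reduced_link K \<and> prime p \<and> determinant K = real p \<longrightarrow>
       (\<forall>C. nontrivial_coloring (residue_ring (int p)) K C \<longrightarrow>
          inj_on C (arcs K) \<and> card (C ` arcs K) = length (crossings K)))"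
proof (rule conjI; intro allI impI)
  obtain s a b where tw: "twist_tangle s T a b"
    using rational_reduced_twist[OF assms(1)] assms(2,3) unfolding reduced_twist_def by blast
  then show "inj_on C (arcs T)" if "nontrivial_coloring \<Z> T C" for C
    using that by (rule distinct_integer_colors)
next
  fix K :: diagram and p :: nat and C :: "nat set \<Rightarrow> int"
  assume K: "K = numerator T \<and> reduced_link K \<and> prime p \<and> determinant K = real p"
    and C: "nontrivial_coloring (residue_ring (int p)) K C"
  have KN: "points K = points T" "crossings K = crossings T"
    "sym_closure (joins K) = sym_closure (joins T) \<union> sym_closure {(NW T, NE T), (SW T, SE T)}"
    using K by (simp_all only: numerator_def points_def sym_closure_Un diagram.simps)
  have p: "int p = b" if "twist_tangle s T a b" for s a b
  proof -
    have "determinant K = of_int b"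
      by (rule determinant_closure[OF that[unfolded twist_tangle_def]])
        (use KN in \<open>auto simp: sym_closure_insert\<close>)
    then show ?thesis using K by (metis of_int_eq_iff of_int_of_nat_eq)
  qed
  have p2: "2 \<le> p" using K prime_ge_2_nat by blast
  have sum: "inj_on C (arcs K) \<and> card (C ` arcs K) = length (crossings K)"
    if T: "rational_twist_form S"
      "T = tangle_sum S (tangle_crossing s) \<or> T = tangle_sum (tangle_crossing s) S" for S s
  proof -
    obtain a b where tw: "0 < a" "twist_tangle s S a b"
      using reduced_twist_sum[OF rational_reduced_twist[OF T(1)] assms(2,3) T(2)] by blast
    \<comment> \<open>The second weight of \<open>T\<close> is the determinant of \<open>K\<close>,
      and it equals the color range of \<open>S\<close>; so \<open>S\<close>, and not
      \<open>T\<close>, is the tangle to be compared with the modulus.\<close>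
    have "twist_tangle s T a (a + b)"
      using T(2) twist_tangle_sum_right[OF tw(2,1)] twist_tangle_sum_left[OF tw(2,1)] by blast
    then have n: "int p = a + b" by (rule p)
    then have prime: "prime (a + b)" using K by (metis prime_nat_int_transfer)
    note C' = C[unfolded n]
    from T(2) show ?thesis
    proof
      assume right: "T = tangle_sum S (tangle_crossing s)"
      show ?thesis
      proof (cases s rule: bool.exhaust[case_names True False])
        case True
        note tS = tw(2)[unfolded True twist_tangle_simps]
        show ?thesis
          by (rule distinct_residue_colors[OF tS twist_crossing_Crossing(1)[of "npoints S" "npoints S + 1" "npoints S + 2" "npoints S + 3"] _ _ _ prime C'])
            (use KN in \<open>auto simp: right True tangle_simps tangle_corners\<close>)
      next
        case False
        note tS = tw(2)[unfolded False twist_tangle_simps]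
        show ?thesis
          by (rule distinct_residue_colors[OF alternating_twist.flip[OF tS] twist_crossing_Crossing(5)[of "npoints S" "npoints S + 1" "npoints S + 2" "npoints S + 3"] _ _ _ prime C'])
            (use KN in \<open>auto simp: right False tangle_simps tangle_corners\<close>)
      qed
    next
      assume left: "T = tangle_sum (tangle_crossing s) S"
      show ?thesis
      proof (cases s rule: bool.exhaust[case_names True False])
        case True
        note tS = tw(2)[unfolded True twist_tangle_simps]
        show ?thesis
          by (rule distinct_residue_colors[OF alternating_twist_shift[OF alternating_twist.flip[OF tS], of 4] twist_crossing_Crossing(2)[of 0 1 2 3] _ _ _ prime C'])
            (use KN in \<open>auto simp: left True tangle_simps tangle_corners\<close>)
      next
        case False
        note tS = tw(2)[unfolded False twist_tangle_simps]
        show ?thesis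
          by (rule distinct_residue_colors[OF alternating_twist_shift[OF tS, of 4] twist_crossing_Crossing(6)[of 0 1 2 3] _ _ _ prime C'])
            (use KN in \<open>auto simp: left False tangle_simps tangle_corners\<close>)
      qed
    qed
  qed
  from assms(1) show "inj_on C (arcs K) \<and> card (C ` arcs K) = length (crossings K)"
  proof cases
    case zero
    \<comment> \<open>The closures of [0] and [\<infinity>] have determinant 0 and 1, neither of
      which is prime.\<close>
    then show ?thesis using p[OF twist_tangle_zero[folded zero]] p2 by simp
  next
    case infinity
    then show ?thesis using p[OF twist_tangle_infinity[folded infinity]] p2 by simp
  next
    case (sum_right S E)
    then show ?thesis using sum by blast
  next
    case (sum_left S E)
    then show ?thesis using sum by blast
  next
    case (star_below S E)
    have "wf_tangle S" using rational_reduced_twist[OF star_below(2)] unfolding reduced_twist_def by blast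
    then show ?thesis using numerator_star_not_reduced(1) star_below K by auto
  next
    case (star_above S E)
    have "wf_tangle S" using rational_reduced_twist[OF star_above(2)] unfolding reduced_twist_def by blast
    then show ?thesis using numerator_star_not_reduced(2) star_above K by auto
  qed
qed

end
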